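(* Let $(A,L_A)$, $(B,L_B)$ and $(C,L_C)$ be compact quantum metric spaces. Then $$\operatorname{dist}_q(A,C)\le \operatorname{dist}_q(A,B)+\operatorname{dist}_q(B,C).$$
   Context: An order-unit space is a real partially ordered vector space $A$ with a distinguished element $e=e_A$ (the order unit) such that (1) for each $a\in A$ there is $r\in\mathbb{R}$ with $a\le re$; (2) if $a\in A$ and $a\le re$ for all real $r>0$, then $a\le 0$. Its norm is $\|a\|=\inf\{r: -re\le a\le re\}$. A state is an element $\mu$ of the Banach-space dual $A'$ with $\mu(e)=1=\|\mu\|'$; $S(A)$ denotes the set of states, with the $w^*$-topology. For a seminorm $L$ on $A$ put $\rho_L(\mu,\nu)=\sup\{|\mu(a)-\nu(a)|: L(a)\le 1\}$ for $\mu,\nu\in S(A)$. A Lip-norm on $A$ is a seminorm $L$ such that $L(a)=0$ iff $a\in\mathbb{R}e$, and the topology on $S(A)$ from $\rho_L$ is the $w^*$-topology. A compact quantum metric space is a pair $(A,L)$ with $A$ an order-unit space and $L$ a Lip-norm on $A$. For compact quantum metric spaces $(A,L_A)$, $(B,L_B)$, the direct sum $A\oplus B$ is an order-unit space with order unit $(e_A,e_B)$ and componentwise order; via the coordinate projections, $S(A)$ and $S(B)$ are viewed as subsets of $S(A\oplus B)$. $\mathcal{M}(L_A,L_B)$ is the set of Lip-norms $L$ on $A\oplus B$ which induce $L_A$ and $L_B$, i.e. $L_A(a)=\inf_{b\in B}L(a,b)$ and $L_B(b)=\inf_{a\in A}L(a,b)$. The quantum Gromov–Hausdorff distance is $\operatorname{dist}_q(A,B)=\inf\{\operatorname{dist}_H^{\rho_L}(S(A),S(B)):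 L\in\mathcal{M}(L_A,L_B)\}$, where $\operatorname{dist}_H^{\rho_L}$ is Hausdorff distance for $\rho_L$. *)

theory Defs
  imports "HOL-Analysis.Analysis"
begin

(* The library has these arities of prod only for ordered_euclidean_space, so every superclass
   of ordered_real_vector has to be generalised, from the bottom up. *)
instance prod :: (ordered_ab_semigroup_add, ordered_ab_semigroup_add) ordered_ab_semigroup_add
  by standard (auto simp: less_eq_prod_def add_left_mono)
instance prod :: (ordered_cancel_ab_semigroup_add, ordered_cancel_ab_semigroup_add) ordered_cancel_ab_semigroup_add ..
instance prod :: (ordered_comm_monoid_add, ordered_comm_monoid_add) ordered_comm_monoid_add ..
instance prod :: (ordered_cancel_comm_monoid_add, ordered_cancel_comm_monoid_add) ordered_cancel_comm_monoid_add ..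
instance prod :: (ordered_ab_semigroup_add_imp_le, ordered_ab_semigroup_add_imp_le) ordered_ab_semigroup_add_imp_le
  by standard (auto simp: less_eq_prod_def add_left_mono)
instance prod :: (ordered_ab_semigroup_monoid_add_imp_le, ordered_ab_semigroup_monoid_add_imp_le) ordered_ab_semigroup_monoid_add_imp_le ..
instance prod :: (ordered_ab_group_add, ordered_ab_group_add) ordered_ab_group_add ..
instance prod :: (ordered_real_vector, ordered_real_vector) ordered_real_vector
  by standard (auto simp: less_eq_prod_def scaleR_left_mono scaleR_right_mono)

definition order_unit_space :: "'a::ordered_real_vector \<Rightarrow> bool" where
  "order_unit_space e \<longleftrightarrow>
     (\<forall>a. \<exists>r. a \<le> r *\<^sub>R e) \<and>
     (\<forall>a. (\<forall>r>0. a \<le> r *\<^sub>R e) \<longrightarrow> a \<le> 0)"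

definition ou_norm :: "'a::ordered_real_vector \<Rightarrow> 'a \<Rightarrow> real" where
  "ou_norm e a = Inf {r. - (r *\<^sub>R e) \<le> a \<and> a \<le> r *\<^sub>R e}"

definition ou_dual :: "'a::ordered_real_vector \<Rightarrow> ('a \<Rightarrow> real) set" where
  "ou_dual e = {\<mu>. linear \<mu> \<and> (\<exists>K. \<forall>a. \<bar>\<mu> a\<bar> \<le> K * ou_norm e a)}"

definition dual_norm :: "'a::ordered_real_vector \<Rightarrow> ('a \<Rightarrow> real) \<Rightarrow> real" where
  "dual_norm e \<mu> = (SUP a\<in>{a. ou_norm e a \<le> 1}. \<bar>\<mu> a\<bar>)"

definition states :: "'a::ordered_real_vector \<Rightarrow> ('a \<Rightarrow> real) set" where
  "states e = {\<mu> \<in> ou_dual e. \<mu> e = 1 \<and> dual_norm e \<mu> = 1}"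

(* The w*-topology is the topology of pointwise convergence on the elements of the space,
   i.e. the one inherited from the product topology on all real functions. *)
definition weak_star :: "'a::ordered_real_vector \<Rightarrow> ('a \<Rightarrow> real) topology" where
  "weak_star e = subtopology (powertop_real UNIV) (states e)"

definition seminorm :: "('a::real_vector \<Rightarrow> real) \<Rightarrow> bool" where
  "seminorm L \<longleftrightarrow>
     (\<forall>a. 0 \<le> L a) \<and>
     (\<forall>a b. L (a + b) \<le> L a + L b) \<and>
     (\<forall>r a. L (r *\<^sub>R a) = \<bar>r\<bar> * L a)"

(* For a seminorm that is not known to be a Lip-norm the supremum may be infinite. *)
definition rho :: "('a \<Rightarrow> real) \<Rightarrow> ('a \<Rightarrow> real) \<Rightarrow> ('a \<Rightarrow> real) \<Rightarrow> ennreal" where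
  "rho L \<mu> \<nu> = (SUP a\<in>{a. L a \<le> 1}. ennreal \<bar>\<mu> a - \<nu> a\<bar>)"

definition rho_topology ::
    "'a::ordered_real_vector \<Rightarrow> ('a \<Rightarrow> real) \<Rightarrow> ('a \<Rightarrow> real) topology" where
  "rho_topology e L =
     topology_generated_by
       {{\<nu> \<in> states e. rho L \<mu> \<nu> < ennreal r} | \<mu> r. \<mu> \<in> states e \<and> 0 < r}"

definition lip_norm :: "'a::ordered_real_vector \<Rightarrow> ('a \<Rightarrow> real) \<Rightarrow> bool" where
  "lip_norm e L \<longleftrightarrow>
     seminorm L \<and>
     (\<forall>a. L a = 0 \<longleftrightarrow> (\<exists>r. a = r *\<^sub>R e)) \<and>
     rho_topology e L = weak_star e"

definition compact_quantum_metric_space ::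
    "'a::ordered_real_vector \<Rightarrow> ('a \<Rightarrow> real) \<Rightarrow> bool" where
  "compact_quantum_metric_space e L \<longleftrightarrow> order_unit_space e \<and> lip_norm e L"

(* The Lip-norms on the direct sum, i.e. on the product type with order unit (eA, eB). *)
definition admissible_lip_norms ::
    "'a::ordered_real_vector \<Rightarrow> ('a \<Rightarrow> real) \<Rightarrow> 'b::ordered_real_vector \<Rightarrow> ('b \<Rightarrow> real)
     \<Rightarrow> ('a \<times> 'b \<Rightarrow> real) set" where
  "admissible_lip_norms eA LA eB LB =
     {L. lip_norm (eA, eB) L \<and>
         (\<forall>a. LA a = (INF b. L (a, b))) \<and>
         (\<forall>b. LB b = (INF a. L (a, b)))}"

(* The infimum over an empty set is infinite, so an empty set has infinite distance
   to any nonempty one. *)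
definition hausdorff_distance ::
    "('p \<Rightarrow> 'p \<Rightarrow> ennreal) \<Rightarrow> 'p set \<Rightarrow> 'p set \<Rightarrow> ennreal" where
  "hausdorff_distance d X Y =
     max (SUP x\<in>X. INF y\<in>Y. d x y) (SUP y\<in>Y. INF x\<in>X. d x y)"

(* The states of the summands are pulled back along the coordinate projections. *)
definition dist_q ::
    "'a::ordered_real_vector \<Rightarrow> ('a \<Rightarrow> real) \<Rightarrow> 'b::ordered_real_vector \<Rightarrow> ('b \<Rightarrow> real)
     \<Rightarrow> ennreal" where
  "dist_q eA LA eB LB =
     (INF L\<in>admissible_lip_norms eA LA eB LB.
        hausdorff_distance (rho L) ((\<lambda>\<mu>. \<mu> \<circ> fst) ` states eA) ((\<lambda>\<nu>. \<nu> \<circ> snd) ` states eB))"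

end

theory Submission
  imports Defs
begin

text \<open>Given admissible \<open>L1\<close> on \<open>A \<oplus> B\<close> and \<open>L2\<close> on \<open>B \<oplus> C\<close>, the seminorm
  \<open>L3 (a, c) = inf\<^sub>b max (L1 (a, b)) (L2 (b, c))\<close> induces \<open>LA\<close> and \<open>LC\<close> and satisfies
  \<open>rho L3 \<mu> \<pi> \<le> rho L1 \<mu> \<nu> + rho L2 \<nu> \<pi>\<close> for states of \<open>A\<close>, \<open>B\<close>, \<open>C\<close>; the triangle inequality for
  Hausdorff distances follows. That \<open>L3\<close> metrises the weak* topology needs no compactness: states
  of \<open>A \<oplus> C\<close> are convex combinations of states of \<open>A\<close> and \<open>C\<close>, on which \<open>L3\<close> dominates \<open>LA\<close> and \<open>LC\<close>.

  The definition of an order-unit space does not force \<open>0 \<le> e\<close>, nor \<open>e \<noteq> 0\<close>. A unit that is not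
  positive or is zero has no states, and such spaces are treated separately.\<close>

section \<open>States\<close>

text \<open>On the reals, \<open>Inf\<close> is defined through \<open>LEAST\<close> over the upper
  bounds of the negated set. When there are none, the predicate is constantly false, just as for
  \<open>UNIV\<close>, so the two unspecified values coincide.\<close>

lemma Inf_real_unbounded:
  fixes X :: "real set"
  assumes "\<not> bdd_below X"
  shows "Inf X = Inf UNIV"
proof -
  have "\<not> (\<forall>x\<in>uminus ` X. x \<le> z)" for z
    using assms unfolding bdd_below_def by (metis image_eqI minus_le_iff)
  moreover have "\<not> (\<forall>x\<in>uminus ` (UNIV :: real set). x \<le> z)" for z
    by (metis UNIV_I add.inverse_inverse gt_ex image_eqI linorder_not_le)
  ultimately have "(\<lambda>z. \<forall>x\<in>uminus ` X. x \<le> z) = (\<lambda>z. \<forall>x\<in>uminus ` (UNIV :: real set). x \<le> z)"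
    by (intro ext) blast
  then show ?thesis
    unfolding Inf_real_def Sup_real_def by (simp only:)
qed

text \<open>If \<open>e\<close> is not positive then \<open>ou_norm e\<close> takes only junk values of \<open>Inf\<close> and \<open>0\<close>, so it is
  bounded and no nonzero functional is dominated by it.\<close>

lemma states_unit_nonneg:
  assumes "\<mu> \<in> states e"
  shows "0 \<le> e"
proof (rule ccontr)
  assume e: "\<not> 0 \<le> e"
  have norm_cases: "ou_norm e a \<in> {Inf UNIV, Inf {}, 0}" for a
  proof -
    define R where "R = {r. - (r *\<^sub>R e) \<le> a \<and> a \<le> r *\<^sub>R e}"
    have double: "0 \<le> (2 * r) *\<^sub>R e" if "r \<in> R" for r
    proof -
      have "- (r *\<^sub>R e) \<le> r *\<^sub>R e" using that unfolding R_def by (auto intro: order_trans)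
      then have "0 \<le> r *\<^sub>R e + r *\<^sub>R e" by (metis add.right_inverse add_left_mono)
      then show ?thesis by (metis mult_2 scaleR_left.add)
    qed
    have nonpos: "r \<le> 0" if "r \<in> R" for r
      using double[OF that] e by (auto simp: zero_le_scaleR_iff)
    show ?thesis
    proof (cases "\<exists>r\<in>R. r < 0")
      case True
      then obtain r where r: "r \<in> R" "r < 0" by blast
      with double[of r] have "e \<le> 0" by (auto simp: zero_le_scaleR_iff)
      \<comment> \<open>A negative member of \<open>R\<close> together with \<open>e \<le> 0\<close>
        puts everything below it into \<open>R\<close>, so the norm of \<open>a\<close> is the
        default value of an unbounded infimum.\<close>
      have "s \<in> R" if "s \<le> r" for s
      proof -
        have "r *\<^sub>R e \<le> s *\<^sub>R e"
          using \<open>e \<le> 0\<close> that by (rule scaleR_right_mono_neg[rotated])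
        then have "- (s *\<^sub>R e) \<le> - (r *\<^sub>R e)" by simp
        with \<open>r *\<^sub>R e \<le> s *\<^sub>R e\<close> show ?thesis
          using r unfolding R_def by (blast intro: order_trans)
      qed
      then have "\<not> bdd_below R"
        unfolding bdd_below_def
        by (metis diff_less_eq less_add_one linorder_not_le min.cobounded1 min.cobounded2 order_le_less_trans)
      then show ?thesis by (simp add: ou_norm_def R_def Inf_real_unbounded)
    next
      case False
      with nonpos have "R \<subseteq> {0}" by fastforce
      then have "R = {} \<or> R = {0}" by blast
      then show ?thesis unfolding ou_norm_def R_def[symmetric] by auto
    qed
  qed
  obtain B where B: "\<And>a. \<bar>ou_norm e a\<bar> \<le> B"
  proof (rule that)
    fix a show "\<bar>ou_norm e a\<bar> \<le> \<bar>Inf UNIV\<bar> + \<bar>Inf {}\<bar>"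
      using norm_cases[of a] by auto
  qed
  obtain K where lin: "linear \<mu>" and "\<mu> e = 1" and K: "\<And>a. \<bar>\<mu> a\<bar> \<le> K * ou_norm e a"
    using assms by (auto simp: states_def ou_dual_def)
  \<comment> \<open>The value of \<open>\<mu>\<close> at \<open>r *\<^sub>R e\<close> is
    \<open>r\<close>, so a bound independent of \<open>r\<close> is absurd.\<close>
  have "r \<le> \<bar>K\<bar> * B" for r
  proof -
    have "r \<le> \<bar>\<mu> (r *\<^sub>R e)\<bar>" using lin \<open>\<mu> e = 1\<close> by (simp add: linear_cmul)
    also have "\<dots> \<le> \<bar>K * ou_norm e (r *\<^sub>R e)\<bar>" using K abs_ge_self order_trans by blast
    also have "\<dots> \<le> \<bar>K\<bar> * B" by (simp add: abs_mult B mult_left_mono)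
    finally show ?thesis .
  qed
  then show False by (meson gt_ex linorder_not_le)
qed

section \<open>States as positive normalised functionals\<close>

lemma linear_mono_of_nonneg:
  fixes \<mu> :: "'a::ordered_real_vector \<Rightarrow> real"
  assumes "linear \<mu>" "\<forall>a\<ge>0. 0 \<le> \<mu> a" "a \<le> b"
  shows "\<mu> a \<le> \<mu> b"
  using assms(2)[rule_format, of "b - a"] assms(3) linear_diff[OF assms(1), of b a] by simp

text \<open>These properties hold for every order unit that has a state, by
  \<open>positive_unitI\<close>, and pass to direct sums, by
  \<open>positive_unit_prod\<close>.\<close>

definition positive_unit :: "'a::ordered_real_vector \<Rightarrow> bool" where
  "positive_unit e \<longleftrightarrow> 0 \<le> e \<and> (\<forall>a. \<exists>r. a \<le> r *\<^sub>R e)"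

lemma positive_unitI:
  "order_unit_space e \<Longrightarrow> \<mu> \<in> states e \<Longrightarrow> positive_unit e"
  by (simp add: positive_unit_def order_unit_space_def states_unit_nonneg)

lemma positive_unit_bound:
  assumes "positive_unit e"
  obtains r where "0 < r" "- (r *\<^sub>R e) \<le> a" "a \<le> r *\<^sub>R e"
proof -
  obtain r s where r: "a \<le> r *\<^sub>R e" and s: "- a \<le> s *\<^sub>R e"
    using assms unfolding positive_unit_def by blast
  define q where "q = max 1 (max r s)"
  have "0 \<le> e" using assms by (simp add: positive_unit_def)
  then have "r *\<^sub>R e \<le> q *\<^sub>R e" "s *\<^sub>R e \<le> q *\<^sub>R e"
    by (auto intro!: scaleR_right_mono simp: q_def)
  with r s have "a \<le> q *\<^sub>R e" "- a \<le> q *\<^sub>R e" by auto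
  then show thesis
    by (intro that[of q]) (auto simp: q_def minus_le_iff)
qed

lemma positive_unit_prod:
  assumes "positive_unit e" "positive_unit f"
  shows "positive_unit (e, f)"
  unfolding positive_unit_def
proof (intro conjI allI)
  show "0 \<le> (e, f)" using assms by (simp add: positive_unit_def less_eq_prod_def)
  fix x :: "'a \<times> 'b"
  obtain a b where x: "x = (a, b)" by fastforce
  obtain r s where r: "a \<le> r *\<^sub>R e" and s: "b \<le> s *\<^sub>R f"
    using assms unfolding positive_unit_def by blast
  have "r *\<^sub>R e \<le> max r s *\<^sub>R e" "s *\<^sub>R f \<le> max r s *\<^sub>R f"
    using assms by (auto intro!: scaleR_right_mono simp: positive_unit_def)
  with r s have "x \<le> max r s *\<^sub>R (e, f)" using x by (auto simp: less_eq_prod_def)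
  then show "\<exists>r. x \<le> r *\<^sub>R (e, f)" ..
qed

text \<open>If \<open>\<mu>\<close> has norm 1 and \<open>0 \<le> a \<le> r *\<^sub>R e\<close>,
  then \<open>e - (1 / r) *\<^sub>R a\<close> lies between \<open>- e\<close> and \<open>e\<close>,
  so \<open>\<bar>1 - \<mu> a / r\<bar> \<le> 1\<close> and \<open>\<mu> a\<close> is nonnegative.
  Conversely, a positive functional is monotone, hence dominated by the norm, and the value 1 is
  attained at \<open>e\<close>.\<close>

lemma states_iff:
  assumes e: "positive_unit e"
  shows "\<mu> \<in> states e \<longleftrightarrow> linear \<mu> \<and> \<mu> e = 1 \<and> (\<forall>a\<ge>0. 0 \<le> \<mu> a)"
proof
  assume \<mu>: "\<mu> \<in> states e"
  then obtain K where lin: "linear \<mu>" and one: "\<mu> e = 1" and dn: "dual_norm e \<mu> = 1"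
    and K: "\<And>a. \<bar>\<mu> a\<bar> \<le> K * ou_norm e a"
    by (auto simp: states_def ou_dual_def)
  have e0: "0 \<le> e" using e by (simp add: positive_unit_def)
  have nonneg: "0 \<le> r" if "- (r *\<^sub>R e) \<le> a" "a \<le> r *\<^sub>R e" for a r
  proof (rule ccontr)
    assume "\<not> 0 \<le> r"
    moreover have "- (r *\<^sub>R e) \<le> r *\<^sub>R e" using that by (rule order_trans)
    then have "0 \<le> r *\<^sub>R e + r *\<^sub>R e" by (metis add.right_inverse add_left_mono)
    then have "0 \<le> (2 * r) *\<^sub>R e" by (metis mult_2 scaleR_left.add)
    ultimately have "e \<le> 0" by (auto simp: zero_le_scaleR_iff)
    with e0 have "e = 0" by simp
    with one lin show False by (simp add: linear_0)
  qed
  have norm_nonneg: "0 \<le> ou_norm e a" for a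
    unfolding ou_norm_def
    by (rule cInf_greatest) (use nonneg positive_unit_bound[OF e, of a] in blast)+
  have norm_le: "ou_norm e a \<le> r" if "- (r *\<^sub>R e) \<le> a" "a \<le> r *\<^sub>R e" for a r
    unfolding ou_norm_def by (rule cInf_lower) (use nonneg that in \<open>auto intro!: bdd_belowI\<close>)
  \<comment> \<open>The real \<open>SUP\<close> in \<open>dual_norm\<close> is an upper bound only
    if the values are bounded; \<open>K\<close> provides this.\<close>
  have bdd: "bdd_above ((\<lambda>a. \<bar>\<mu> a\<bar>) ` {a. ou_norm e a \<le> 1})"
  proof (rule bdd_aboveI2)
    fix a assume "a \<in> {a. ou_norm e a \<le> 1}"
    then have "K * ou_norm e a \<le> \<bar>K\<bar> * 1" using norm_nonneg by (intro mult_mono) auto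
    then show "\<bar>\<mu> a\<bar> \<le> \<bar>K\<bar>" using K[of a] by simp
  qed
  have le1: "\<bar>\<mu> a\<bar> \<le> 1" if "ou_norm e a \<le> 1" for a
    using cSUP_upper[OF _ bdd, of a] that dn by (simp add: dual_norm_def)
  have "0 \<le> \<mu> a" if a: "0 \<le> a" for a
  proof -
    obtain r where r: "0 < r" "a \<le> r *\<^sub>R e" using positive_unit_bound[OF e] by metis
    have "(1 / r) *\<^sub>R a \<le> (1 / r) *\<^sub>R (r *\<^sub>R e)" using r by (intro scaleR_left_mono) auto
    then have "(1 / r) *\<^sub>R a \<le> e" using r by simp
    moreover have "0 \<le> (1 / r) *\<^sub>R a" using r a by (simp add: zero_le_scaleR_iff)
    moreover have "- e \<le> e - e" using e0 by simp
    ultimately have "- e \<le> e - (1 / r) *\<^sub>R a" "e - (1 / r) *\<^sub>R a \<le> e"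
      using diff_left_mono order_trans by (blast, simp)
    then have "ou_norm e (e - (1 / r) *\<^sub>R a) \<le> 1"
      by (intro norm_le) auto
    then have "\<bar>1 - \<mu> a / r\<bar> \<le> 1"
      using le1 lin one by (fastforce simp: linear_diff linear_cmul)
    then have "0 \<le> \<mu> a / r" by linarith
    then show ?thesis using r by (simp add: zero_le_divide_iff)
  qed
  with lin one show "linear \<mu> \<and> \<mu> e = 1 \<and> (\<forall>a\<ge>0. 0 \<le> \<mu> a)" by blast
next
  assume "linear \<mu> \<and> \<mu> e = 1 \<and> (\<forall>a\<ge>0. 0 \<le> \<mu> a)"
  then have lin: "linear \<mu>" and one: "\<mu> e = 1" and pos: "\<forall>a\<ge>0. 0 \<le> \<mu> a" by auto
  note mono = linear_mono_of_nonneg[OF lin pos]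
  have abs_le: "\<bar>\<mu> a\<bar> \<le> r" if "- (r *\<^sub>R e) \<le> a" "a \<le> r *\<^sub>R e" for a r
    using mono[OF that(1)] mono[OF that(2)] lin one by (simp add: linear_cmul linear_neg)
  have le_norm: "\<bar>\<mu> a\<bar> \<le> ou_norm e a" for a
    unfolding ou_norm_def
    by (rule cInf_greatest) (use abs_le positive_unit_bound[OF e, of a] in blast)+
  have "0 \<le> e" using e by (simp add: positive_unit_def)
  then have "- e \<le> e" by (meson neg_le_0_iff_le order_trans)
  moreover have "0 \<le> r" if "- (r *\<^sub>R e) \<le> e" "e \<le> r *\<^sub>R e" for r
    using abs_le[OF that] by simp
  ultimately have "ou_norm e e \<le> 1"
    unfolding ou_norm_def by (intro cInf_lower bdd_belowI[of _ 0]) auto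
  moreover have "\<bar>\<mu> a\<bar> \<le> 1" if "ou_norm e a \<le> 1" for a
    using le_norm[of a] that by simp
  ultimately have "dual_norm e \<mu> = 1"
    unfolding dual_norm_def using one by (intro cSup_eq_maximum) (auto intro: rev_image_eqI[of e])
  moreover have "\<mu> \<in> ou_dual e"
    unfolding ou_dual_def using lin le_norm by (auto intro!: exI[of _ 1])
  ultimately show "\<mu> \<in> states e" using one by (simp add: states_def)
qed

lemma states_linear: "\<mu> \<in> states e \<Longrightarrow> linear \<mu>"
  and states_unit: "\<mu> \<in> states e \<Longrightarrow> \<mu> e = 1"
  by (auto simp: states_def ou_dual_def)

text \<open>States are monotone, so one interval from \<open>- (r *\<^sub>R e)\<close> to
  \<open>r *\<^sub>R e\<close> containing \<open>a\<close> serves all of them.\<close>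

lemma states_pointwise_bounded:
  assumes e: "positive_unit e"
  obtains r where "0 < r" "\<And>\<mu>. \<mu> \<in> states e \<Longrightarrow> \<bar>\<mu> a\<bar> \<le> r"
proof -
  obtain r where r: "0 < r" "- (r *\<^sub>R e) \<le> a" "a \<le> r *\<^sub>R e" using positive_unit_bound[OF e] by metis
  have "\<bar>\<mu> a\<bar> \<le> r" if "\<mu> \<in> states e" for \<mu>
  proof -
    have "linear \<mu>" "\<mu> e = 1" "\<forall>a\<ge>0. 0 \<le> \<mu> a" using that states_iff[OF e] by auto
    then show ?thesis
      using linear_mono_of_nonneg[of \<mu>, OF _ _ r(2)] linear_mono_of_nonneg[of \<mu>, OF _ _ r(3)]
      by (simp add: linear_cmul linear_neg)
  qed
  with r(1) that show thesis by blast
qed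

lemma states_finite_bounded:
  assumes e: "positive_unit e" and "finite F"
  obtains r where "0 < r" "\<And>\<mu> a. \<mu> \<in> states e \<Longrightarrow> a \<in> F \<Longrightarrow> \<bar>\<mu> a\<bar> \<le> r"
proof -
  have "\<exists>r>0. \<forall>\<mu>\<in>states e. \<forall>a\<in>F. \<bar>\<mu> a\<bar> \<le> r" using \<open>finite F\<close>
  proof (induction F)
    case empty
    then show ?case by (auto intro: exI[of _ 1])
  next
    case (insert a F)
    then obtain r where r: "r > 0" "\<forall>\<mu>\<in>states e. \<forall>a\<in>F. \<bar>\<mu> a\<bar> \<le> r" by blast
    obtain s where s: "0 < s" "\<And>\<mu>. \<mu> \<in> states e \<Longrightarrow> \<bar>\<mu> a\<bar> \<le> s"
      using states_pointwise_bounded[OF e] by blast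
    show ?case
      by (rule exI[of _ "max r s"]) (use r s in \<open>fastforce simp: le_max_iff_disj\<close>)
  qed
  then show thesis using that by blast
qed

lemma states_convex:
  assumes e: "positive_unit e" and "\<mu> \<in> states e" "\<nu> \<in> states e" "0 \<le> t" "t \<le> 1"
  shows "(\<lambda>a. (1 - t) * \<mu> a + t * \<nu> a) \<in> states e"
  using assms(2-) unfolding states_iff[OF e]
  by (safe intro!: linearI add_nonneg_nonneg mult_nonneg_nonneg)
    (auto simp: linear_add linear_cmul algebra_simps)

section \<open>States of a direct sum\<close>

lemma states_fst:
  assumes "positive_unit e" "positive_unit f" "\<mu> \<in> states e"
  shows "\<mu> \<circ> fst \<in> states (e, f)"
  using assms(3) unfolding states_iff[OF assms(1)] states_iff[OF positive_unit_prod[OF assms(1,2)]]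
  by (auto simp: less_eq_prod_def linear_compose[OF linear_fst])

lemma states_snd:
  assumes "positive_unit e" "positive_unit f" "\<mu> \<in> states f"
  shows "\<mu> \<circ> snd \<in> states (e, f)"
  using assms(3) unfolding states_iff[OF assms(2)] states_iff[OF positive_unit_prod[OF assms(1,2)]]
  by (auto simp: less_eq_prod_def linear_compose[OF linear_snd])

text \<open>Division by \<open>\<phi> e\<close> normalises \<open>\<phi>\<close>. If
  \<open>\<phi> e = 0\<close>, squeezing elements between multiples of \<open>e\<close> gives
  \<open>\<phi> = 0\<close>, and any state will do; \<open>ne\<close> guarantees one in that
  case.\<close>

lemma positive_functional_eq_scaled_state:
  assumes e: "positive_unit e" and lin: "linear \<phi>" and pos: "\<forall>a\<ge>0. 0 \<le> \<phi> a"
    and ne: "\<phi> e \<noteq> 0 \<or> states e \<noteq> {}"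
  obtains \<mu> where "\<mu> \<in> states e" "\<And>a. \<phi> a = \<phi> e * \<mu> a"
proof (cases "\<phi> e = 0")
  case True
  have "\<phi> a = 0" for a
  proof -
    obtain r where r: "- (r *\<^sub>R e) \<le> a" "a \<le> r *\<^sub>R e" using positive_unit_bound[OF e] by metis
    show ?thesis
      using linear_mono_of_nonneg[OF lin pos r(1)] linear_mono_of_nonneg[OF lin pos r(2)] True lin by (simp add: linear_cmul linear_neg)
  qed
  with ne True that show thesis by auto
next
  case False
  have "0 \<le> \<phi> e" using e pos by (simp add: positive_unit_def)
  with False have "(\<lambda>a. \<phi> a / \<phi> e) \<in> states e"
    unfolding states_iff[OF e] using lin pos
    by (auto intro!: linearI simp: linear_add linear_cmul add_divide_distrib)
  then show thesis using False by (intro that) auto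
qed

lemma state_prod_parts:
  fixes e :: "'a::ordered_real_vector" and f :: "'b::ordered_real_vector"
  assumes e: "positive_unit e" and f: "positive_unit f" and \<nu>: "\<nu> \<in> states (e, f)"
  shows "linear (\<lambda>a. \<nu> (a, 0))" "linear (\<lambda>b. \<nu> (0, b))"
    "\<forall>a\<ge>0. 0 \<le> \<nu> (a, 0)" "\<forall>b\<ge>0. 0 \<le> \<nu> (0, b)"
    "\<nu> (a, b) = \<nu> (a, 0) + \<nu> (0, b)" "\<nu> (e, 0) + \<nu> (0, f) = 1"
proof -
  have lin: "linear \<nu>" and one: "\<nu> (e, f) = 1" and pos: "\<And>x. 0 \<le> x \<Longrightarrow> 0 \<le> \<nu> x"
    using \<nu> states_iff[OF positive_unit_prod[OF e f]] by auto
  show split: "\<nu> (a, b) = \<nu> (a, 0) + \<nu> (0, b)" for a b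
    using linear_add[OF lin, of "(a, 0)" "(0, b)"] by simp
  show "\<nu> (e, 0) + \<nu> (0, f) = 1" using split[of e f] one by simp
  have "linear (\<lambda>a. (a, 0 :: 'b))" "linear (\<lambda>b. (0 :: 'a, b))" by (auto intro!: linearI)
  then show "linear (\<lambda>a. \<nu> (a, 0))" "linear (\<lambda>b. \<nu> (0, b))"
    using linear_compose[OF _ lin] by (fastforce simp: comp_def)+
qed (use \<nu> states_iff[OF positive_unit_prod[OF e f]] in \<open>auto simp: less_eq_prod_def\<close>)

text \<open>The restrictions of \<open>\<nu>\<close> to the summands are positive functionals whose
  masses \<open>\<nu> (e, 0)\<close> and \<open>\<nu> (0, f)\<close> add up to 1. These masses are
  the weights; a summand of mass 0 receives an arbitrary state.\<close>

lemma state_prod_decompose: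
  assumes e: "positive_unit e" and f: "positive_unit f" and \<nu>: "\<nu> \<in> states (e, f)"
    and ne: "states e \<noteq> {}" "states f \<noteq> {}"
  obtains t \<mu> \<pi> where "0 \<le> t" "t \<le> 1" "\<mu> \<in> states e" "\<pi> \<in> states f"
    "\<nu> = (\<lambda>x. t * \<mu> (fst x) + (1 - t) * \<pi> (snd x))"
proof -
  note parts = state_prod_parts[OF e f \<nu>]
  obtain \<mu> where \<mu>: "\<mu> \<in> states e" "\<And>a. \<nu> (a, 0) = \<nu> (e, 0) * \<mu> a"
    by (rule positive_functional_eq_scaled_state[OF e parts(1) parts(3)]) (use ne in blast)+
  obtain \<pi> where \<pi>: "\<pi> \<in> states f" "\<And>a. \<nu> (0, a) = \<nu> (0, f) * \<pi> a"
    by (rule positive_functional_eq_scaled_state[OF f parts(2) parts(4)]) (use ne in blast)+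
  have "0 \<le> \<nu> (e, 0)" "0 \<le> \<nu> (0, f)" using parts(3,4) e f by (auto simp: positive_unit_def)
  moreover have "\<nu> (0, f) = 1 - \<nu> (e, 0)" using parts(6) by simp
  moreover have "\<nu> = (\<lambda>x. \<nu> (e, 0) * \<mu> (fst x) + (1 - \<nu> (e, 0)) * \<pi> (snd x))"
  proof
    fix x
    show "\<nu> x = \<nu> (e, 0) * \<mu> (fst x) + (1 - \<nu> (e, 0)) * \<pi> (snd x)"
      using parts(5)[of "fst x" "snd x"] \<mu>(2)[of "fst x"] \<pi>(2)[of "snd x"]
        \<open>\<nu> (0, f) = 1 - \<nu> (e, 0)\<close> by simp
  qed
  ultimately show thesis
    by (intro that[OF _ _ \<mu>(1) \<pi>(1)]) (assumption | linarith)+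
qed

text \<open>A state of the sum makes both units positive. Its restrictions have total mass 1, so one
  of them can be normalised to a state of a summand.\<close>

lemma states_prod_empty:
  assumes A: "order_unit_space e" "states e = {}" and B: "order_unit_space f" "states f = {}"
  shows "states (e, f) = {}"
proof (rule ccontr)
  assume "states (e, f) \<noteq> {}"
  then obtain \<nu> where \<nu>: "\<nu> \<in> states (e, f)" by blast
  then have "0 \<le> (e, f)" by (rule states_unit_nonneg)
  then have e: "positive_unit e" and f: "positive_unit f"
    using A(1) B(1) unfolding positive_unit_def order_unit_space_def less_eq_prod_def by force+
  note parts = state_prod_parts[OF e f \<nu>]
  have "\<nu> (e, 0) = 0"
    by (rule ccontr, rule positive_functional_eq_scaled_state[OF e parts(1) parts(3)]) (use A(2) in blast)+
  moreover have "\<nu> (0, f) = 0"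
    by (rule ccontr, rule positive_functional_eq_scaled_state[OF f parts(2) parts(4)]) (use B(2) in blast)+
  ultimately show False using parts(6) by simp
qed

section \<open>Lip-norms\<close>

text \<open>Basic open sets of the product topology constrain finitely many coordinates, and the
  smallest of their radii serves as a common \<open>\<delta>\<close>.\<close>

lemma openin_weak_star_iff:
  "openin (weak_star e) U \<longleftrightarrow> U \<subseteq> states e \<and>
     (\<forall>\<mu>\<in>U. \<exists>F \<delta>. finite F \<and> 0 < \<delta> \<and> {\<nu> \<in> states e. \<forall>a\<in>F. \<bar>\<nu> a - \<mu> a\<bar> < \<delta>} \<subseteq> U)"
    (is "_ \<longleftrightarrow> _ \<and> ?nbhds")
proof (intro iffI conjI)
  assume "openin (weak_star e) U"
  then obtain V where V: "openin (powertop_real UNIV) V" and U: "U = V \<inter> states e"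
    by (auto simp: weak_star_def openin_subtopology)
  show "U \<subseteq> states e" using U by simp
  show ?nbhds
  proof
    fix \<mu> assume "\<mu> \<in> U"
    with U have "\<mu> \<in> V" by simp
    with V obtain W where fin: "finite {i. W i \<noteq> UNIV}" and op: "\<And>i. open (W i)"
      and mem: "\<mu> \<in> Pi\<^sub>E UNIV W" and sub: "Pi\<^sub>E UNIV W \<subseteq> V"
      unfolding openin_product_topology_alt by auto
    have "\<exists>d>0. \<forall>y. \<bar>y - \<mu> i\<bar> < d \<longrightarrow> y \<in> W i" for i
      using op[of i] mem unfolding open_dist dist_real_def by blast
    then obtain d where d: "\<And>i. 0 < d i" "\<And>i y. \<bar>y - \<mu> i\<bar> < d i \<Longrightarrow> y \<in> W i" by metis
    define F where "F = {i. W i \<noteq> UNIV}"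
    \<comment> \<open>The extra 1 keeps the minimum defined when \<open>F\<close> is empty.\<close>
    define \<delta> where "\<delta> = Min (insert 1 (d ` F))"
    have "0 < \<delta>" and le: "\<And>i. i \<in> F \<Longrightarrow> \<delta> \<le> d i"
      using d(1) fin by (auto simp: \<delta>_def F_def)
    have "\<nu> \<in> Pi\<^sub>E UNIV W" if "\<forall>a\<in>F. \<bar>\<nu> a - \<mu> a\<bar> < \<delta>" for \<nu>
    proof -
      have "\<nu> i \<in> W i" for i
        using that le d(2)[of "\<nu> i" i] by (cases "i \<in> F") (fastforce simp: F_def)+
      then show ?thesis by auto
    qed
    then have "{\<nu> \<in> states e. \<forall>a\<in>F. \<bar>\<nu> a - \<mu> a\<bar> < \<delta>} \<subseteq> U" using U sub by blast
    with fin \<open>0 < \<delta>\<close> show "\<exists>F \<delta>. finite F \<and> 0 < \<delta> \<and> {\<nu> \<in> states e. \<forall>a\<in>F. \<bar>\<nu> a - \<mu> a\<bar> < \<delta>} \<subseteq> U"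
      unfolding F_def by blast
  qed
next
  assume R: "U \<subseteq> states e \<and> ?nbhds"
  show "openin (weak_star e) U"
  proof (subst openin_subopen, intro ballI)
    fix \<mu> assume \<mu>: "\<mu> \<in> U"
    with R obtain F \<delta> where F: "finite F" "0 < \<delta>" "{\<nu> \<in> states e. \<forall>a\<in>F. \<bar>\<nu> a - \<mu> a\<bar> < \<delta>} \<subseteq> U"
      by blast
    have "open {\<nu> :: 'a \<Rightarrow> real. \<forall>a\<in>F. \<bar>\<nu> a - \<mu> a\<bar> < \<delta>}"
    proof -
      have "open {\<nu> :: 'a \<Rightarrow> real. \<bar>\<nu> a - \<mu> a\<bar> < \<delta>}" for a
        by (intro open_Collect_less continuous_intros continuous_on_product_coordinates)
      moreover have "{\<nu> :: 'a \<Rightarrow> real. \<forall>a\<in>F. \<bar>\<nu> a - \<mu> a\<bar> < \<delta>} = (\<Inter>a\<in>F. {\<nu>. \<bar>\<nu> a - \<mu> a\<bar> < \<delta>})"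
        by blast
      ultimately show ?thesis using F(1) by auto
    qed
    then have "openin (powertop_real UNIV) {\<nu> :: 'a \<Rightarrow> real. \<forall>a\<in>F. \<bar>\<nu> a - \<mu> a\<bar> < \<delta>}"
      by (simp add: euclidean_product_topology)
    then have "openin (weak_star e) ({\<nu>. \<forall>a\<in>F. \<bar>\<nu> a - \<mu> a\<bar> < \<delta>} \<inter> states e)"
      by (auto simp: weak_star_def openin_subtopology)
    then show "\<exists>T. openin (weak_star e) T \<and> \<mu> \<in> T \<and> T \<subseteq> U"
      using F \<mu> R
      by (intro exI[of _ "{\<nu>. \<forall>a\<in>F. \<bar>\<nu> a - \<mu> a\<bar> < \<delta>} \<inter> states e"]) auto
  qed
qed

section \<open>The metric of a seminorm against the weak* topology\<close>

lemma rho_le_iff: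
  assumes "0 \<le> k"
  shows "rho L \<mu> \<nu> \<le> ennreal k \<longleftrightarrow> (\<forall>a. L a \<le> 1 \<longrightarrow> \<bar>\<mu> a - \<nu> a\<bar> \<le> k)"
  using assms by (auto simp: rho_def SUP_le_iff ennreal_le_iff)

lemma seminorm_zero: "seminorm L \<Longrightarrow> L 0 = 0"
  unfolding seminorm_def by (metis abs_zero mult_zero_left scaleR_zero_left)

lemma seminorm_nonneg: "seminorm L \<Longrightarrow> 0 \<le> L a"
  by (simp add: seminorm_def)

lemma seminorm_scale: "seminorm L \<Longrightarrow> L (r *\<^sub>R a) = \<bar>r\<bar> * L a"
  by (simp add: seminorm_def)

lemma seminorm_triangle: "seminorm L \<Longrightarrow> L (a + b) \<le> L a + L b"
  by (simp add: seminorm_def)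

text \<open>Rescaling by \<open>1 / s\<close> moves \<open>a\<close> into the unit ball. A positive
  upper bound \<open>s\<close> takes the place of \<open>L a\<close>, which may vanish.\<close>

lemma states_diff_scaled:
  assumes L: "seminorm L" and lin: "linear \<mu>" "linear \<nu>"
    and k: "\<And>a. L a \<le> 1 \<Longrightarrow> \<bar>\<mu> a - \<nu> a\<bar> \<le> k" and s: "0 < s" "L a \<le> s"
  shows "\<bar>\<mu> a - \<nu> a\<bar> \<le> k * s"
proof -
  have "L ((1 / s) *\<^sub>R a) \<le> 1" using s by (simp add: seminorm_scale[OF L])
  then have "\<bar>\<mu> ((1 / s) *\<^sub>R a) - \<nu> ((1 / s) *\<^sub>R a)\<bar> \<le> k" by (rule k)
  then have "\<bar>(\<mu> a - \<nu> a) / s\<bar> \<le> k" using lin by (simp add: linear_cmul diff_divide_distrib)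
  then show ?thesis using s by (simp add: pos_divide_le_eq)
qed

text \<open>Evaluations are always continuous for \<open>rho\<close>, so this is all that the equality of the two
  topologies adds.\<close>

definition rho_weak_star_continuous :: "'a::ordered_real_vector \<Rightarrow> ('a \<Rightarrow> real) \<Rightarrow> bool" where
  "rho_weak_star_continuous e L \<longleftrightarrow>
     (\<forall>\<mu>\<in>states e. \<forall>\<epsilon>>0. \<exists>F \<delta>. finite F \<and> 0 < \<delta> \<and>
        (\<forall>\<nu>\<in>states e. (\<forall>a\<in>F. \<bar>\<nu> a - \<mu> a\<bar> < \<delta>) \<longrightarrow> (\<forall>a. L a \<le> 1 \<longrightarrow> \<bar>\<mu> a - \<nu> a\<bar> \<le> \<epsilon>)))"

lemma openin_rho_ball:
  assumes "\<mu> \<in> states e" "0 < r"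
  shows "openin (rho_topology e L) {\<nu> \<in> states e. rho L \<mu> \<nu> < ennreal r}"
  unfolding rho_topology_def by (rule topology_generated_by_Basis) (use assms in blast)

lemma rho_same: "rho L \<mu> \<mu> = 0"
  using rho_le_iff[of 0 L \<mu> \<mu>] by simp

text \<open>Continuity at each point of a \<open>rho\<close>-ball and the triangle inequality make
  the ball weak* open. In the other direction, evaluation at \<open>a\<close> is Lipschitz for
  \<open>rho\<close> with any positive constant above \<open>L a\<close>, so weak* neighbourhoods
  contain balls.\<close>

lemma rho_weak_star_continuous_iff:
  assumes L: "seminorm L" and ker: "\<And>a. L a = 0 \<Longrightarrow> \<exists>r. a = r *\<^sub>R e"
  shows "rho_topology e L = weak_star e \<longleftrightarrow> rho_weak_star_continuous e L"
proof
  assume eq: "rho_topology e L = weak_star e"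
  show "rho_weak_star_continuous e L"
    unfolding rho_weak_star_continuous_def
  proof (intro ballI allI impI)
    fix \<mu> and \<epsilon> :: real assume \<mu>: "\<mu> \<in> states e" and \<epsilon>: "0 < \<epsilon>"
    define U where "U = {\<nu> \<in> states e. rho L \<mu> \<nu> < ennreal \<epsilon>}"
    have "openin (weak_star e) U" using openin_rho_ball[OF \<mu> \<epsilon>, of L] eq by (simp add: U_def)
    moreover have "\<mu> \<in> U" using \<mu> \<epsilon> by (simp add: U_def rho_same)
    ultimately obtain F \<delta> where F: "finite F" "0 < \<delta>"
      "{\<nu> \<in> states e. \<forall>a\<in>F. \<bar>\<nu> a - \<mu> a\<bar> < \<delta>} \<subseteq> U"
      unfolding openin_weak_star_iff by blast
    have "\<bar>\<mu> a - \<nu> a\<bar> \<le> \<epsilon>" if "\<nu> \<in> states e" "\<forall>a\<in>F. \<bar>\<nu> a - \<mu> a\<bar> < \<delta>" "L a \<le> 1" for \<nu> a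
    proof -
      have "rho L \<mu> \<nu> \<le> ennreal \<epsilon>" using F(3) that U_def by auto
      then show ?thesis using rho_le_iff[of \<epsilon> L \<mu> \<nu>] \<epsilon> that(3) by auto
    qed
    with F show "\<exists>F \<delta>. finite F \<and> 0 < \<delta> \<and> (\<forall>\<nu>\<in>states e. (\<forall>a\<in>F. \<bar>\<nu> a - \<mu> a\<bar> < \<delta>) \<longrightarrow>
        (\<forall>a. L a \<le> 1 \<longrightarrow> \<bar>\<mu> a - \<nu> a\<bar> \<le> \<epsilon>))"
      by blast
  qed
next
  assume cont: "rho_weak_star_continuous e L"
  have ball_open: "openin (weak_star e) {\<nu> \<in> states e. rho L \<mu> \<nu> < ennreal r}"
    if \<mu>: "\<mu> \<in> states e" and r: "0 < r" for \<mu> r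
    unfolding openin_weak_star_iff
  proof (intro conjI ballI)
    fix \<nu> assume "\<nu> \<in> {\<nu> \<in> states e. rho L \<mu> \<nu> < ennreal r}"
    then have \<nu>: "\<nu> \<in> states e" and lt: "rho L \<mu> \<nu> < ennreal r" by auto
    then obtain k where k: "0 \<le> k" "rho L \<mu> \<nu> = ennreal k"
      by (cases "rho L \<mu> \<nu>") (auto simp: top_unique)
    with lt have "k < r" by (simp add: ennreal_less_iff)
    \<comment> \<open>Half of the room left between \<open>\<nu>\<close> and the boundary of the
      ball.\<close>
    define \<epsilon> where "\<epsilon> = (r - k) / 2"
    have \<epsilon>: "0 < \<epsilon>" "k + \<epsilon> < r" using \<open>k < r\<close> by (auto simp: \<epsilon>_def field_simps)
    then obtain F \<delta> where F: "finite F" "0 < \<delta>"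
      "\<And>\<nu>' a. \<nu>' \<in> states e \<Longrightarrow> (\<forall>a\<in>F. \<bar>\<nu>' a - \<nu> a\<bar> < \<delta>) \<Longrightarrow> L a \<le> 1 \<Longrightarrow> \<bar>\<nu> a - \<nu>' a\<bar> \<le> \<epsilon>"
      using cont[unfolded rho_weak_star_continuous_def, rule_format, OF \<nu> \<epsilon>(1)] by blast
    have "rho L \<mu> \<nu>' < ennreal r" if "\<nu>' \<in> states e" "\<forall>a\<in>F. \<bar>\<nu>' a - \<nu> a\<bar> < \<delta>" for \<nu>'
    proof -
      have "\<bar>\<mu> a - \<nu>' a\<bar> \<le> k + \<epsilon>" if "L a \<le> 1" for a
      proof -
        have "\<bar>\<mu> a - \<nu> a\<bar> \<le> k" using rho_le_iff[OF k(1), of L \<mu> \<nu>] k(2) that by simp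
        with F(3)[OF \<open>\<nu>' \<in> states e\<close> \<open>\<forall>a\<in>F. _\<close> that] show ?thesis by linarith
      qed
      then have "rho L \<mu> \<nu>' \<le> ennreal (k + \<epsilon>)" using rho_le_iff[of "k + \<epsilon>" L \<mu> \<nu>'] k \<epsilon> by auto
      also have "\<dots> < ennreal r" using \<epsilon> k by (simp add: ennreal_less_iff del: ennreal_plus)
      finally show ?thesis .
    qed
    with F show "\<exists>F \<delta>. finite F \<and> 0 < \<delta> \<and>
      {\<nu>' \<in> states e. \<forall>a\<in>F. \<bar>\<nu>' a - \<nu> a\<bar> < \<delta>} \<subseteq> {\<nu> \<in> states e. rho L \<mu> \<nu> < ennreal r}"
      by blast
  qed auto
  have weak_open: "openin (rho_topology e L) U" if "openin (weak_star e) U" for U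
  proof (subst openin_subopen, intro ballI)
    fix \<mu> assume "\<mu> \<in> U"
    with that have \<mu>: "\<mu> \<in> states e" by (auto simp: openin_weak_star_iff)
    from that \<open>\<mu> \<in> U\<close> obtain F \<delta> where F: "finite F" "0 < \<delta>"
      "{\<nu> \<in> states e. \<forall>a\<in>F. \<bar>\<nu> a - \<mu> a\<bar> < \<delta>} \<subseteq> U"
      unfolding openin_weak_star_iff by blast
    \<comment> \<open>A common bound for \<open>L\<close> on \<open>F\<close>; the 1 makes it
      positive, so that \<open>\<delta>\<close> can be divided by it.\<close>
    define c where "c = Max (insert 1 (L ` F))"
    have c: "1 \<le> c" "\<And>a. a \<in> F \<Longrightarrow> L a \<le> c" using F(1) by (auto simp: c_def)
    define r where "r = \<delta> / (2 * c)"
    have r: "0 < r" "r * c < \<delta>" using F(2) c(1) by (auto simp: r_def)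
    have "\<nu> \<in> U" if \<nu>: "\<nu> \<in> states e" and lt: "rho L \<mu> \<nu> < ennreal r" for \<nu>
    proof -
      have k: "\<bar>\<mu> a - \<nu> a\<bar> \<le> r" if "L a \<le> 1" for a
        using rho_le_iff[of r L \<mu> \<nu>] r(1) lt that by auto
      have "\<bar>\<mu> a - \<nu> a\<bar> \<le> r * c" if "a \<in> F" for a
        by (rule states_diff_scaled[OF L states_linear[OF \<mu>] states_linear[OF \<nu>] k])
          (use c that in auto)
      then have "\<bar>\<nu> a - \<mu> a\<bar> < \<delta>" if "a \<in> F" for a
        using r(2) that by (metis abs_minus_commute le_less_trans)
      with F(3) \<nu> show ?thesis by blast
    qed
    then show "\<exists>T. openin (rho_topology e L) T \<and> \<mu> \<in> T \<and> T \<subseteq> U"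
      using openin_rho_ball[OF \<mu> r(1), of L] \<mu> r(1)
      by (intro exI[of _ "{\<nu> \<in> states e. rho L \<mu> \<nu> < ennreal r}"]) (auto simp: rho_same)
  qed
  have rho_open: "openin (weak_star e) U" if "openin (rho_topology e L) U" for U
    using that unfolding rho_topology_def openin_topology_generated_by_iff
  proof (induction rule: generate_topology_on.induct)
    case (UN K)
    then show ?case by (intro openin_Union) blast
  next
    case (Basis s)
    then show ?case using ball_open by blast
  qed (simp_all add: openin_Int)
  show "rho_topology e L = weak_star e"
    unfolding topology_eq by (intro allI iffI) (erule rho_open, erule weak_open)
qed

lemma lip_norm_iff:
  "lip_norm e L \<longleftrightarrow>
     seminorm L \<and> (\<forall>a. L a = 0 \<longleftrightarrow> (\<exists>r. a = r *\<^sub>R e)) \<and> rho_weak_star_continuous e L"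
proof (cases "seminorm L \<and> (\<forall>a. L a = 0 \<longleftrightarrow> (\<exists>r. a = r *\<^sub>R e))")
  case True
  then have "rho_topology e L = weak_star e \<longleftrightarrow> rho_weak_star_continuous e L"
    by (intro rho_weak_star_continuous_iff) (simp, metis)
  with True show ?thesis by (simp only: lip_norm_def)
next
  case False
  then show ?thesis unfolding lip_norm_def by blast
qed

text \<open>A convex combination \<open>(1 - t) \<mu> + t \<nu>\<close> with small \<open>t\<close> lies in a given weak* neighbourhood of
  \<open>\<mu>\<close> uniformly in \<open>\<nu>\<close>, while its \<open>rho\<close>-distance to \<open>\<mu>\<close> is \<open>t\<close> times that of \<open>\<nu>\<close>. Hence the
  diameter is finite, without appeal to compactness.\<close>

lemma lip_norm_diameter_finite:
  assumes e: "positive_unit e" and L: "lip_norm e L"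
  obtains M where "0 \<le> M"
    "\<And>\<mu> \<nu> a. \<mu> \<in> states e \<Longrightarrow> \<nu> \<in> states e \<Longrightarrow> L a \<le> 1 \<Longrightarrow> \<bar>\<mu> a - \<nu> a\<bar> \<le> M"
proof (cases "states e = {}")
  case True
  then show thesis using that[of 0] by blast
next
  case False
  then obtain \<mu> where \<mu>: "\<mu> \<in> states e" by blast
  have "rho_weak_star_continuous e L" using L by (simp add: lip_norm_iff)
  from this[unfolded rho_weak_star_continuous_def, rule_format, OF \<mu>, of 1]
obtain F and \<delta> :: real where F: "finite F" "0 < \<delta>"
    "\<And>\<nu> a. \<nu> \<in> states e \<Longrightarrow> (\<forall>a\<in>F. \<bar>\<nu> a - \<mu> a\<bar> < \<delta>) \<Longrightarrow> L a \<le> 1 \<Longrightarrow> \<bar>\<mu> a - \<nu> a\<bar> \<le> 1"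
    by auto
  obtain r where r: "0 < r" "\<And>\<mu> a. \<mu> \<in> states e \<Longrightarrow> a \<in> F \<Longrightarrow> \<bar>\<mu> a\<bar> \<le> r"
    using states_finite_bounded[OF e F(1)] by blast
  \<comment> \<open>States differ by at most \<open>2 * r\<close> on \<open>F\<close>, so moving a
    fraction \<open>t\<close> towards any state stays within \<open>2 * \<delta> / 3\<close>
    there.\<close>
  define t where "t = min 1 (\<delta> / (3 * r))"
  have t: "0 < t" "t \<le> 1" "t * (2 * r) < \<delta>"
    using F(2) r(1) by (auto simp: t_def min_def field_simps)
  have bound: "\<bar>\<mu> a - \<nu> a\<bar> \<le> 1 / t" if \<nu>: "\<nu> \<in> states e" and a: "L a \<le> 1" for \<nu> a
  proof -
    define \<nu>' where "\<nu>' = (\<lambda>a. (1 - t) * \<mu> a + t * \<nu> a)"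
    have "\<nu>' \<in> states e" unfolding \<nu>'_def using t by (intro states_convex e \<mu> \<nu>) auto
    moreover have diff: "\<nu>' x - \<mu> x = t * (\<nu> x - \<mu> x)" for x by (simp add: \<nu>'_def algebra_simps)
    have "\<forall>x\<in>F. \<bar>\<nu>' x - \<mu> x\<bar> < \<delta>"
    proof
      fix x assume "x \<in> F"
      then have "\<bar>\<nu> x - \<mu> x\<bar> \<le> 2 * r" using r(2)[OF \<mu>, of x] r(2)[OF \<nu>, of x] by linarith
      then have "\<bar>\<nu>' x - \<mu> x\<bar> \<le> t * (2 * r)" using t(1) by (simp add: diff abs_mult)
      with t(3) show "\<bar>\<nu>' x - \<mu> x\<bar> < \<delta>" by linarith
    qed
    ultimately have "\<bar>\<mu> a - \<nu>' a\<bar> \<le> 1" using F(3) a by blast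
    then have "t * \<bar>\<mu> a - \<nu> a\<bar> \<le> 1"
      using diff[of a] t(1) by (simp add: abs_minus_commute[of "\<mu> a"] abs_mult)
    then show ?thesis using t(1) by (simp add: field_simps)
  qed
  \<comment> \<open>Two arbitrary states are compared through the fixed
    \<open>\<mu>\<close>.\<close>
  have "\<bar>\<nu> a - \<nu>' a\<bar> \<le> 2 / t" if "\<nu> \<in> states e" "\<nu>' \<in> states e" "L a \<le> 1" for \<nu> \<nu>' a
    using bound[OF that(1,3)] bound[OF that(2,3)] by linarith
  with t(1) show thesis by (intro that[of "2 / t"]) auto
qed

section \<open>Gluing admissible Lip-norms\<close>

lemma real_INF_eqI:
  fixes f :: "'i \<Rightarrow> real"
  assumes lower: "\<And>i. m \<le> f i" and approx: "\<And>\<epsilon>. 0 < \<epsilon> \<Longrightarrow> \<exists>i. f i < m + \<epsilon>"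
  shows "m = (INF i. f i)"
proof (rule antisym)
  show "m \<le> (INF i. f i)" by (rule cINF_greatest) (use lower in auto)
  have bdd: "bdd_below (range f)" using lower by (auto intro: bdd_belowI[of _ m])
  show "(INF i. f i) \<le> m"
  proof (rule field_le_epsilon)
    fix \<epsilon> :: real assume "0 < \<epsilon>"
    then obtain i where "f i < m + \<epsilon>" using approx by blast
    moreover have "(INF i. f i) \<le> f i" using bdd by (rule cINF_lower) simp
    ultimately show "(INF i. f i) \<le> m + \<epsilon>" by linarith
  qed
qed

lemma real_INF_lower:
  fixes f :: "'i \<Rightarrow> real"
  assumes "\<And>i. 0 \<le> f i"
  shows "(INF i. f i) \<le> f i"
  using assms by (intro cINF_lower) (auto intro: bdd_belowI[of _ 0])

lemma real_INF_approx:
  fixes f :: "'i \<Rightarrow> real"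
  assumes nonneg: "\<And>i. 0 \<le> f i" and less: "(INF i. f i) < s"
  obtains i where "f i < s"
proof -
  have "bdd_below (range f)" using nonneg by (auto intro: bdd_belowI[of _ 0])
  then have "\<exists>i\<in>UNIV. f i < s" using less cINF_less_iff[of UNIV f s] by simp
  then show thesis using that by blast
qed

lemma admissible_lip_norm: "L \<in> admissible_lip_norms eA LA eB LB \<Longrightarrow> lip_norm (eA, eB) L"
  by (simp add: admissible_lip_norms_def)

lemma admissible_seminorm: "L \<in> admissible_lip_norms eA LA eB LB \<Longrightarrow> seminorm L"
  by (simp add: admissible_lip_norms_def lip_norm_def)

lemma admissible_le:
  assumes "L \<in> admissible_lip_norms eA LA eB LB"
  shows "LA a \<le> L (a, b)" "LB b \<le> L (a, b)"
  using real_INF_lower[of "\<lambda>b. L (a, b)" b] real_INF_lower[of "\<lambda>a. L (a, b)" a]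
    seminorm_nonneg[OF admissible_seminorm[OF assms]] assms
  by (auto simp: admissible_lip_norms_def)

lemma admissible_approx_fst:
  assumes "L \<in> admissible_lip_norms eA LA eB LB" "LA a < s"
  obtains b where "L (a, b) < s"
  using real_INF_approx[of "\<lambda>b. L (a, b)" s] seminorm_nonneg[OF admissible_seminorm[OF assms(1)]] assms
  by (auto simp: admissible_lip_norms_def)

lemma admissible_approx_snd:
  assumes "L \<in> admissible_lip_norms eA LA eB LB" "LB b < s"
  obtains a where "L (a, b) < s"
  using real_INF_approx[of "\<lambda>a. L (a, b)" s] seminorm_nonneg[OF admissible_seminorm[OF assms(1)]] assms
  by (auto simp: admissible_lip_norms_def)

text \<open>The quotient on the outer summands of \<open>max (L1 (a, b)) (L2 (b, c))\<close> on the triple direct sum.\<close>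

definition glued :: "('a \<times> 'b \<Rightarrow> real) \<Rightarrow> ('b \<times> 'c \<Rightarrow> real) \<Rightarrow> 'a \<times> 'c \<Rightarrow> real" where
  "glued L1 L2 x = (INF b. max (L1 (fst x, b)) (L2 (b, snd x)))"

context
  fixes L1 :: "'a::real_vector \<times> 'b::real_vector \<Rightarrow> real" and L2 :: "'b \<times> 'c::real_vector \<Rightarrow> real"
  assumes L1: "seminorm L1" and L2: "seminorm L2"
begin

lemma glued_nonneg: "0 \<le> glued L1 L2 x"
  unfolding glued_def by (rule cINF_greatest) (use seminorm_nonneg[OF L1] in \<open>auto simp: le_max_iff_disj\<close>)

lemma glued_le: "glued L1 L2 (a, c) \<le> max (L1 (a, b)) (L2 (b, c))"
  unfolding glued_def fst_conv snd_conv
  by (rule real_INF_lower) (simp add: le_max_iff_disj seminorm_nonneg[OF L1])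

text \<open>The infimum over \<open>b\<close> need not be attained, so later arguments work with
  strict slack and a near-minimiser.\<close>

lemma glued_approx:
  assumes "glued L1 L2 (a, c) < s"
  obtains b where "L1 (a, b) < s" "L2 (b, c) < s"
proof -
  obtain b where "max (L1 (a, b)) (L2 (b, c)) < s"
    by (rule real_INF_approx[of "\<lambda>b. max (L1 (a, b)) (L2 (b, c))" s])
      (use assms seminorm_nonneg[OF L1] in \<open>auto simp: glued_def le_max_iff_disj\<close>)
  then show thesis by (intro that) auto
qed

lemma glued_triangle: "glued L1 L2 (x + y) \<le> glued L1 L2 x + glued L1 L2 y"
proof (rule field_le_epsilon)
  fix \<epsilon> :: real assume \<epsilon>: "0 < \<epsilon>"
  obtain a c a' c' where x: "x = (a, c)" and y: "y = (a', c')" by fastforce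
  obtain b where b: "L1 (a, b) < glued L1 L2 x + \<epsilon> / 2" "L2 (b, c) < glued L1 L2 x + \<epsilon> / 2"
    using glued_approx[of a c "glued L1 L2 x + \<epsilon> / 2"] \<epsilon> x by auto
  obtain b' where b': "L1 (a', b') < glued L1 L2 y + \<epsilon> / 2" "L2 (b', c') < glued L1 L2 y + \<epsilon> / 2"
    using glued_approx[of a' c' "glued L1 L2 y + \<epsilon> / 2"] \<epsilon> y by auto
  have "glued L1 L2 (x + y) \<le> max (L1 (a + a', b + b')) (L2 (b + b', c + c'))"
    using glued_le[of "a + a'" "c + c'" "b + b'"] x y by simp
  moreover have "L1 (a + a', b + b') \<le> L1 (a, b) + L1 (a', b')"
    using seminorm_triangle[OF L1, of "(a, b)" "(a', b')"] by simp
  moreover have "L2 (b + b', c + c') \<le> L2 (b, c) + L2 (b', c')"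
    using seminorm_triangle[OF L2, of "(b, c)" "(b', c')"] by simp
  ultimately show "glued L1 L2 (x + y) \<le> glued L1 L2 x + glued L1 L2 y + \<epsilon>"
    using b b' by linarith
qed

text \<open>A near-minimiser \<open>b\<close> for \<open>x\<close> scales to
  \<open>r *\<^sub>R b\<close>. The reverse inequality comes in \<open>seminorm_glued\<close> from
  this one applied to \<open>1 / r\<close>.\<close>

lemma glued_scale_le:
  assumes "r \<noteq> 0"
  shows "glued L1 L2 (r *\<^sub>R x) \<le> \<bar>r\<bar> * glued L1 L2 x"
proof (rule field_le_epsilon)
  fix \<epsilon> :: real assume \<epsilon>: "0 < \<epsilon>"
  obtain a c where x: "x = (a, c)" by fastforce
  define s where "s = glued L1 L2 x + \<epsilon> / \<bar>r\<bar>"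
  have s: "glued L1 L2 x < s" "\<bar>r\<bar> * s = \<bar>r\<bar> * glued L1 L2 x + \<epsilon>"
    using \<epsilon> assms by (auto simp: s_def distrib_left)
  then obtain b where "L1 (a, b) < s" "L2 (b, c) < s"
    using glued_approx x by metis
  then have "\<bar>r\<bar> * L1 (a, b) \<le> \<bar>r\<bar> * s" "\<bar>r\<bar> * L2 (b, c) \<le> \<bar>r\<bar> * s"
    by (auto intro: mult_left_mono)
  then have "max (L1 (r *\<^sub>R (a, b))) (L2 (r *\<^sub>R (b, c))) \<le> \<bar>r\<bar> * s"
    by (simp only: seminorm_scale[OF L1] seminorm_scale[OF L2] max.bounded_iff)
  then show "glued L1 L2 (r *\<^sub>R x) \<le> \<bar>r\<bar> * glued L1 L2 x + \<epsilon>"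
    using glued_le[of "r *\<^sub>R a" "r *\<^sub>R c" "r *\<^sub>R b"] s(2) x
    by (simp del: max.bounded_iff)
qed

lemma seminorm_glued: "seminorm (glued L1 L2)"
  unfolding seminorm_def
proof (intro conjI allI)
  fix r x
  show "glued L1 L2 (r *\<^sub>R x) = \<bar>r\<bar> * glued L1 L2 x"
  proof (cases "r = 0")
    case True
    have "glued L1 L2 (0, 0) \<le> max (L1 (0, 0)) (L2 (0, 0))" by (rule glued_le)
    then have "glued L1 L2 0 \<le> 0" using seminorm_zero[OF L1] seminorm_zero[OF L2] by (simp add: zero_prod_def)
    with True glued_nonneg[of 0] show ?thesis by simp
  next
    case False
    have "glued L1 L2 x \<le> \<bar>1 / r\<bar> * glued L1 L2 (r *\<^sub>R x)"
      using glued_scale_le[of "1 / r" "r *\<^sub>R x"] False by simp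
    then have "\<bar>r\<bar> * glued L1 L2 x \<le> glued L1 L2 (r *\<^sub>R x)"
      using False by (simp add: field_simps)
    with glued_scale_le[OF False] show ?thesis by (rule antisym)
  qed
qed (use glued_nonneg glued_triangle in auto)

end

text \<open>Both terms of the maximum dominate the marginals from below. For the upper bound,
  \<open>a\<close> is lifted to some \<open>b\<close> with \<open>L1 (a, b)\<close> close to
  \<open>LA a\<close>; then \<open>LB b\<close> is below the same threshold, so \<open>b\<close>
  lifts in turn to some \<open>c\<close>. The other marginal runs from \<open>c\<close> back to
  \<open>a\<close>.\<close>

lemma glued_marginals:
  assumes L1: "L1 \<in> admissible_lip_norms eA LA eB LB" and L2: "L2 \<in> admissible_lip_norms eB LB eC LC"
  shows "LA a = (INF c. glued L1 L2 (a, c))" "LC c = (INF a. glued L1 L2 (a, c))"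
proof -
  note le = glued_le[OF admissible_seminorm[OF L1] admissible_seminorm[OF L2]]
  have lower: "LA a \<le> glued L1 L2 (a, c)" "LC c \<le> glued L1 L2 (a, c)" for a c
    unfolding glued_def
    by (rule cINF_greatest; use admissible_le[OF L1] admissible_le[OF L2] in \<open>simp add: le_max_iff_disj\<close>)+
  show "LA a = (INF c. glued L1 L2 (a, c))"
  proof (rule real_INF_eqI)
    fix \<epsilon> :: real assume "0 < \<epsilon>"
    then obtain b where b: "L1 (a, b) < LA a + \<epsilon>"
      using admissible_approx_fst[OF L1, of a "LA a + \<epsilon>"] by auto
    then have "LB b < LA a + \<epsilon>" using admissible_le(2)[OF L1, of b a] by simp
    then obtain c where "L2 (b, c) < LA a + \<epsilon>" using admissible_approx_fst[OF L2] by blast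
    with b le[of a c b] show "\<exists>c. glued L1 L2 (a, c) < LA a + \<epsilon>" by (intro exI[of _ c]) linarith
  qed (rule lower)
  show "LC c = (INF a. glued L1 L2 (a, c))"
  proof (rule real_INF_eqI)
    fix \<epsilon> :: real assume "0 < \<epsilon>"
    then obtain b where b: "L2 (b, c) < LC c + \<epsilon>"
      using admissible_approx_snd[OF L2, of c "LC c + \<epsilon>"] by auto
    then have "LB b < LC c + \<epsilon>" using admissible_le(1)[OF L2, of b c] by simp
    then obtain a where "L1 (a, b) < LC c + \<epsilon>" using admissible_approx_snd[OF L1] by blast
    with b le[of a c b] show "\<exists>a. glued L1 L2 (a, c) < LC c + \<epsilon>" by (intro exI[of _ a]) linarith
  qed (rule lower)
qed

text \<open>A weak* neighbourhood of a state of a direct sum controls only the weight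
  \<open>t\<close> and the scaled functional \<open>t \<mu>\<close>, not \<open>\<mu>\<close>. If
  \<open>t = 0\<close> the claim is trivial; otherwise continuity at \<open>\<mu>\<close> is used
  with tolerance \<open>\<epsilon> / t\<close>.\<close>

lemma rho_weak_star_continuous_scaled:
  assumes e: "positive_unit e" and cont: "rho_weak_star_continuous e L"
    and \<mu>: "\<mu> \<in> states e" and t: "0 \<le> t" and \<epsilon>: "0 < \<epsilon>"
  obtains F \<delta> where "finite F" "0 < \<delta>"
    "\<forall>\<mu>'\<in>states e. \<forall>t'. \<bar>t' - t\<bar> < \<delta> \<longrightarrow> (\<forall>a\<in>F. \<bar>t' * \<mu>' a - t * \<mu> a\<bar> < \<delta>) \<longrightarrow>
      (\<forall>a. L a \<le> 1 \<longrightarrow> t * \<bar>\<mu> a - \<mu>' a\<bar> \<le> \<epsilon>)"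
proof (cases "t = 0")
  case True
  then show thesis using \<epsilon> by (intro that[of "{}" 1]) auto
next
  case False
  with t have t: "0 < t" by simp
  obtain F \<delta> where F: "finite F" and \<delta>: "0 < \<delta>" and
    near: "\<forall>\<nu>\<in>states e. (\<forall>a\<in>F. \<bar>\<nu> a - \<mu> a\<bar> < \<delta>) \<longrightarrow> (\<forall>a. L a \<le> 1 \<longrightarrow> \<bar>\<mu> a - \<nu> a\<bar> \<le> \<epsilon> / t)"
    using cont[unfolded rho_weak_star_continuous_def, THEN bspec, OF \<mu>, THEN spec, THEN mp,
        OF divide_pos_pos[OF \<epsilon> t]]
    by (elim exE conjE)
  obtain k where k: "0 < k" "\<And>\<mu> a. \<mu> \<in> states e \<Longrightarrow> a \<in> F \<Longrightarrow> \<bar>\<mu> a\<bar> \<le> k"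
    using states_finite_bounded[OF e F] by blast
  \<comment> \<open>Chosen so that the errors from the scaled functional and from the weight,
    \<open>\<delta>'\<close> and \<open>\<delta>' * k\<close>, add up to
    \<open>t * \<delta>\<close>.\<close>
  define \<delta>' where "\<delta>' = t * \<delta> / (1 + k)"
  have \<delta>': "0 < \<delta>'" "\<delta>' * (1 + k) = t * \<delta>" using t \<delta> k(1) by (auto simp: \<delta>'_def)
  show thesis
  proof (rule that[OF F \<delta>'(1)], intro ballI allI impI)
    fix \<mu>' t' a
    assume \<mu>': "\<mu>' \<in> states e" and t': "\<bar>t' - t\<bar> < \<delta>'"
      and close: "\<forall>a\<in>F. \<bar>t' * \<mu>' a - t * \<mu> a\<bar> < \<delta>'" and a: "L a \<le> 1"
    have "\<bar>\<mu>' x - \<mu> x\<bar> < \<delta>" if x: "x \<in> F" for x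
    proof -
      have "t * (\<mu>' x - \<mu> x) = (t' * \<mu>' x - t * \<mu> x) - (t' - t) * \<mu>' x" by (simp add: algebra_simps)
      moreover have "\<bar>(t' - t) * \<mu>' x\<bar> \<le> \<delta>' * k"
        unfolding abs_mult using t' k(2)[OF \<mu>' x] \<delta>'(1) by (intro mult_mono) auto
      ultimately have "\<bar>t * (\<mu>' x - \<mu> x)\<bar> < \<delta>' + \<delta>' * k" using close[rule_format, OF x] by linarith
      also have "\<dots> = t * \<delta>" using \<delta>'(2) by (simp add: distrib_left)
      finally show ?thesis using t by (simp add: abs_mult)
    qed
    then have "\<bar>\<mu> a - \<mu>' a\<bar> \<le> \<epsilon> / t" using near \<mu>' a by blast
    then show "t * \<bar>\<mu> a - \<mu>' a\<bar> \<le> \<epsilon>" using t by (simp add: field_simps)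
  qed
qed

section \<open>The glued seminorm when all three spaces have states\<close>

locale gluing =
  fixes eA :: "'a::ordered_real_vector" and LA :: "'a \<Rightarrow> real"
    and eB :: "'b::ordered_real_vector" and LB :: "'b \<Rightarrow> real"
    and eC :: "'c::ordered_real_vector" and LC :: "'c \<Rightarrow> real"
    and L1 :: "'a \<times> 'b \<Rightarrow> real" and L2 :: "'b \<times> 'c \<Rightarrow> real"
  assumes eA: "positive_unit eA" and eB: "positive_unit eB" and eC: "positive_unit eC"
    and SA: "states eA \<noteq> {}" and SB: "states eB \<noteq> {}" and SC: "states eC \<noteq> {}"
    and LA: "lip_norm eA LA" and LC: "lip_norm eC LC"
    and L1: "L1 \<in> admissible_lip_norms eA LA eB LB"
    and L2: "L2 \<in> admissible_lip_norms eB LB eC LC"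
begin

abbreviation "L3 \<equiv> glued L1 L2"

lemmas s1 = admissible_seminorm[OF L1] and s2 = admissible_seminorm[OF L2]

lemma scaled_diff1:
  assumes "\<mu> \<in> states eA" "\<nu> \<in> states eB" "\<And>a b. L1 (a, b) \<le> 1 \<Longrightarrow> \<bar>\<mu> a - \<nu> b\<bar> \<le> k"
    "0 < s" "L1 (a, b) \<le> s"
  shows "\<bar>\<mu> a - \<nu> b\<bar> \<le> k * s"
proof -
  have "\<bar>(\<mu> \<circ> fst) (a, b) - (\<nu> \<circ> snd) (a, b)\<bar> \<le> k * s"
    using assms(3,4,5)
    by (intro states_diff_scaled[OF s1] states_linear[OF states_fst[OF eA eB assms(1)]]
        states_linear[OF states_snd[OF eA eB assms(2)]]) auto
  then show ?thesis by simp
qed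

lemma scaled_diff2:
  assumes "\<nu> \<in> states eB" "\<pi> \<in> states eC" "\<And>b c. L2 (b, c) \<le> 1 \<Longrightarrow> \<bar>\<nu> b - \<pi> c\<bar> \<le> k"
    "0 < s" "L2 (b, c) \<le> s"
  shows "\<bar>\<nu> b - \<pi> c\<bar> \<le> k * s"
proof -
  have "\<bar>(\<nu> \<circ> fst) (b, c) - (\<pi> \<circ> snd) (b, c)\<bar> \<le> k * s"
    using assms(3,4,5)
    by (intro states_diff_scaled[OF s2] states_linear[OF states_fst[OF eB eC assms(1)]]
        states_linear[OF states_snd[OF eB eC assms(2)]]) auto
  then show ?thesis by simp
qed

text \<open>For \<open>s\<close> above \<open>L3 (a, c)\<close> some \<open>b\<close> has
  \<open>L1 (a, b)\<close> and \<open>L2 (b, c)\<close> below \<open>s\<close>. Passing through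
  \<open>\<nu> b\<close> costs \<open>k1 * s + k2 * s\<close>, and \<open>s\<close> then decreases
  to \<open>L3 (a, c)\<close>.\<close>

lemma glued_diff:
  assumes \<mu>: "\<mu> \<in> states eA" and \<nu>: "\<nu> \<in> states eB" and \<pi>: "\<pi> \<in> states eC"
    and k1: "\<And>a b. L1 (a, b) \<le> 1 \<Longrightarrow> \<bar>\<mu> a - \<nu> b\<bar> \<le> k1"
    and k2: "\<And>b c. L2 (b, c) \<le> 1 \<Longrightarrow> \<bar>\<nu> b - \<pi> c\<bar> \<le> k2"
  shows "\<bar>\<mu> a - \<pi> c\<bar> \<le> (k1 + k2) * L3 (a, c)"
proof -
  \<comment> \<open>Zero lies in the unit ball, so the assumed bound applies to it.\<close>
  have "0 \<le> k1" using k1[of 0 0] seminorm_zero[OF s1] by (simp add: zero_prod_def)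
  moreover have "0 \<le> k2" using k2[of 0 0] seminorm_zero[OF s2] by (simp add: zero_prod_def)
  ultimately have k: "0 \<le> k1 + k2" by simp
  have bound: "\<bar>\<mu> a - \<pi> c\<bar> \<le> (k1 + k2) * s" if "L3 (a, c) < s" for s
  proof -
    obtain b where b: "L1 (a, b) < s" "L2 (b, c) < s"
      using glued_approx[OF s1 s2 \<open>L3 (a, c) < s\<close>] by blast
    have "0 < s" using that glued_nonneg[OF s1 s2, of "(a, c)"] by simp
    then have "\<bar>\<mu> a - \<nu> b\<bar> \<le> k1 * s" "\<bar>\<nu> b - \<pi> c\<bar> \<le> k2 * s"
      using b scaled_diff1[OF \<mu> \<nu> k1] scaled_diff2[OF \<nu> \<pi> k2] by auto
    then show ?thesis by (simp add: distrib_right)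
  qed
  show ?thesis
  proof (rule field_le_epsilon)
    fix \<epsilon> :: real assume \<epsilon>: "0 < \<epsilon>"
    define \<eta> where "\<eta> = \<epsilon> / (k1 + k2 + 1)"
    have "0 < \<eta>" using \<epsilon> k by (simp add: \<eta>_def)
    have "(k1 + k2) * \<eta> \<le> (k1 + k2 + 1) * \<eta>" using \<open>0 < \<eta>\<close> by (simp add: mult_right_mono)
    also have "\<dots> = \<epsilon>" using k by (simp add: \<eta>_def)
    finally show "\<bar>\<mu> a - \<pi> c\<bar> \<le> (k1 + k2) * L3 (a, c) + \<epsilon>"
      using bound[of "L3 (a, c) + \<eta>"] \<open>0 < \<eta>\<close> by (simp add: distrib_left)
  qed
qed

lemma rho_glued_triangle:
  assumes \<mu>: "\<mu> \<in> states eA" and \<nu>: "\<nu> \<in> states eB" and \<pi>: "\<pi> \<in> states eC"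
  shows "rho L3 (\<mu> \<circ> fst) (\<pi> \<circ> snd) \<le> rho L1 (\<mu> \<circ> fst) (\<nu> \<circ> snd) + rho L2 (\<nu> \<circ> fst) (\<pi> \<circ> snd)"
proof (cases "rho L1 (\<mu> \<circ> fst) (\<nu> \<circ> snd) = top \<or> rho L2 (\<nu> \<circ> fst) (\<pi> \<circ> snd) = top")
  case True
  then show ?thesis by auto
next
  case False
  then obtain k1 k2 where k: "0 \<le> k1" "0 \<le> k2"
    and r: "rho L1 (\<mu> \<circ> fst) (\<nu> \<circ> snd) = ennreal k1" "rho L2 (\<nu> \<circ> fst) (\<pi> \<circ> snd) = ennreal k2"
    by (metis ennreal_cases)
  have k1: "\<bar>\<mu> a - \<nu> b\<bar> \<le> k1" if "L1 (a, b) \<le> 1" for a b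
    using rho_le_iff[OF k(1), of L1 "\<mu> \<circ> fst" "\<nu> \<circ> snd"] r(1) that by auto
  have k2: "\<bar>\<nu> b - \<pi> c\<bar> \<le> k2" if "L2 (b, c) \<le> 1" for b c
    using rho_le_iff[OF k(2), of L2 "\<nu> \<circ> fst" "\<pi> \<circ> snd"] r(2) that by auto
  have "\<bar>\<mu> a - \<pi> c\<bar> \<le> k1 + k2" if "L3 (a, c) \<le> 1" for a c
    using glued_diff[OF \<mu> \<nu> \<pi> k1 k2, of a c] mult_left_mono[OF that, of "k1 + k2"] k by simp
  then have "rho L3 (\<mu> \<circ> fst) (\<pi> \<circ> snd) \<le> ennreal (k1 + k2)"
    using rho_le_iff[of "k1 + k2" L3] k by auto
  then show ?thesis using r k by simp
qed

text \<open>Any fixed state of \<open>B\<close> serves as intermediate point, and the diameters for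
  \<open>L1\<close> and \<open>L2\<close> are finite.\<close>

lemma glued_diameter:
  obtains M where "0 \<le> M"
    "\<And>\<mu> \<pi> a c. \<mu> \<in> states eA \<Longrightarrow> \<pi> \<in> states eC \<Longrightarrow> \<bar>\<mu> a - \<pi> c\<bar> \<le> M * L3 (a, c)"
proof -
  obtain M1 where M1: "0 \<le> M1" "\<And>\<mu> \<nu> x. \<mu> \<in> states (eA, eB) \<Longrightarrow> \<nu> \<in> states (eA, eB) \<Longrightarrow>
      L1 x \<le> 1 \<Longrightarrow> \<bar>\<mu> x - \<nu> x\<bar> \<le> M1"
    using lip_norm_diameter_finite[OF positive_unit_prod[OF eA eB] admissible_lip_norm[OF L1]] by blast
  obtain M2 where M2: "0 \<le> M2" "\<And>\<mu> \<nu> x. \<mu> \<in> states (eB, eC) \<Longrightarrow> \<nu> \<in> states (eB, eC) \<Longrightarrow>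
      L2 x \<le> 1 \<Longrightarrow> \<bar>\<mu> x - \<nu> x\<bar> \<le> M2"
    using lip_norm_diameter_finite[OF positive_unit_prod[OF eB eC] admissible_lip_norm[OF L2]] by blast
  obtain \<nu> where \<nu>: "\<nu> \<in> states eB" using SB by blast
  show thesis
  proof (rule that[of "M1 + M2"])
    fix \<mu> \<pi> a c assume \<mu>: "\<mu> \<in> states eA" and \<pi>: "\<pi> \<in> states eC"
    show "\<bar>\<mu> a - \<pi> c\<bar> \<le> (M1 + M2) * L3 (a, c)"
    proof (rule glued_diff[OF \<mu> \<nu> \<pi>])
      show "\<bar>\<mu> a - \<nu> b\<bar> \<le> M1" if "L1 (a, b) \<le> 1" for a b
        using M1(2)[OF states_fst[OF eA eB \<mu>] states_snd[OF eA eB \<nu>] that] by simp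
      show "\<bar>\<nu> b - \<pi> c\<bar> \<le> M2" if "L2 (b, c) \<le> 1" for b c
        using M2(2)[OF states_fst[OF eB eC \<nu>] states_snd[OF eB eC \<pi>] that] by simp
    qed
  qed (use M1 M2 in simp)
qed

lemma glued_ge:
  shows "LA a \<le> L3 (a, c)" "LC c \<le> L3 (a, c)"
proof -
  note nonneg = glued_nonneg[OF s1 s2]
  show "LA a \<le> L3 (a, c)"
    unfolding glued_marginals(1)[OF L1 L2] by (rule real_INF_lower[OF nonneg])
  show "LC c \<le> L3 (a, c)"
    unfolding glued_marginals(2)[OF L1 L2] by (rule real_INF_lower[OF nonneg])
qed

text \<open>If \<open>L3\<close> vanishes at \<open>x\<close>, so do both marginals, and the
  components are multiples \<open>r\<close> and \<open>s\<close> of the units. By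
  \<open>glued_diameter\<close> states of \<open>A\<close> and \<open>C\<close> then agree on them,
  which forces \<open>r = s\<close>. For the converse, \<open>r *\<^sub>R eB\<close> is the middle
  element.\<close>

lemma glued_kernel: "L3 x = 0 \<longleftrightarrow> (\<exists>r. x = r *\<^sub>R (eA, eC))"
proof
  assume zero: "L3 x = 0"
  obtain a c where x: "x = (a, c)" by fastforce
  have "0 \<le> LA a" "0 \<le> LC c" using LA LC by (auto simp: lip_norm_def seminorm_nonneg)
  then have "LA a = 0" "LC c = 0" using glued_ge[where a = a and c = c] zero x by auto
  then obtain r s where r: "a = r *\<^sub>R eA" and s: "c = s *\<^sub>R eC"
    using LA LC unfolding lip_norm_def by blast
  obtain \<mu> \<pi> where \<mu>: "\<mu> \<in> states eA" and \<pi>: "\<pi> \<in> states eC" using SA SC by blast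
  obtain M where "\<bar>\<mu> a - \<pi> c\<bar> \<le> M * L3 (a, c)" using glued_diameter \<mu> \<pi> by metis
  then have "\<mu> a = \<pi> c" using zero x by simp
  then have "r = s"
    using states_linear[OF \<mu>] states_linear[OF \<pi>] states_unit[OF \<mu>] states_unit[OF \<pi>] r s
    by (simp add: linear_cmul)
  with r s x show "\<exists>r. x = r *\<^sub>R (eA, eC)" by auto
next
  assume "\<exists>r. x = r *\<^sub>R (eA, eC)"
  then obtain r where x: "x = (r *\<^sub>R eA, r *\<^sub>R eC)" by auto
  have "L1 (r *\<^sub>R (eA, eB)) = 0" "L2 (r *\<^sub>R (eB, eC)) = 0"
    using admissible_lip_norm[OF L1] admissible_lip_norm[OF L2] unfolding lip_norm_def by blast+
  then have "L3 x \<le> 0" using glued_le[OF s1 s2, of "r *\<^sub>R eA" "r *\<^sub>R eC" "r *\<^sub>R eB"] x by simp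
  with glued_nonneg[OF s1 s2, of x] show "L3 x = 0" by simp
qed

text \<open>For states \<open>t \<mu> \<oplus> (1 - t) \<pi>\<close> and \<open>t' \<mu>' \<oplus> (1 - t') \<pi>'\<close> of the direct sum, the distance is at
  most \<open>t d(\<mu>, \<mu>') + (1 - t) d(\<pi>, \<pi>') + \<bar>t - t'\<bar> M\<close>, where \<open>d\<close> comes from \<open>LA\<close> and \<open>LC\<close> and \<open>M\<close>
  bounds the distance between a state of \<open>A\<close> and a state of \<open>C\<close>.\<close>

lemma glued_continuous: "rho_weak_star_continuous (eA, eC) L3"
  unfolding rho_weak_star_continuous_def
proof (intro ballI allI impI)
  fix \<nu> and \<epsilon> :: real assume \<nu>: "\<nu> \<in> states (eA, eC)" and \<epsilon>: "0 < \<epsilon>"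
  obtain t \<mu> \<pi> where t: "0 \<le> t" "t \<le> 1" and \<mu>: "\<mu> \<in> states eA" and \<pi>: "\<pi> \<in> states eC"
    and eq: "\<nu> = (\<lambda>x. t * \<mu> (fst x) + (1 - t) * \<pi> (snd x))"
    by (rule state_prod_decompose[OF eA eC \<nu> SA SC])
  obtain M where M: "0 \<le> M"
    "\<And>\<mu> \<pi> a c. \<mu> \<in> states eA \<Longrightarrow> \<pi> \<in> states eC \<Longrightarrow> \<bar>\<mu> a - \<pi> c\<bar> \<le> M * L3 (a, c)"
    using glued_diameter by blast
  have contA: "rho_weak_star_continuous eA LA" and contC: "rho_weak_star_continuous eC LC"
    using LA LC by (auto simp: lip_norm_iff)
  have "0 < \<epsilon> / 3" "0 \<le> 1 - t" using \<epsilon> t by auto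
  obtain F1 \<delta>1 where F1: "finite F1" "0 < \<delta>1" and near1:
    "\<forall>\<mu>'\<in>states eA. \<forall>t'. \<bar>t' - t\<bar> < \<delta>1 \<longrightarrow> (\<forall>a\<in>F1. \<bar>t' * \<mu>' a - t * \<mu> a\<bar> < \<delta>1) \<longrightarrow>
      (\<forall>a. LA a \<le> 1 \<longrightarrow> t * \<bar>\<mu> a - \<mu>' a\<bar> \<le> \<epsilon> / 3)"
    by (rule rho_weak_star_continuous_scaled[OF eA contA \<mu> t(1) \<open>0 < \<epsilon> / 3\<close>])
  obtain F2 \<delta>2 where F2: "finite F2" "0 < \<delta>2" and near2:
    "\<forall>\<pi>'\<in>states eC. \<forall>t'. \<bar>t' - (1 - t)\<bar> < \<delta>2 \<longrightarrow>
      (\<forall>a\<in>F2. \<bar>t' * \<pi>' a - (1 - t) * \<pi> a\<bar> < \<delta>2) \<longrightarrow>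
      (\<forall>a. LC a \<le> 1 \<longrightarrow> (1 - t) * \<bar>\<pi> a - \<pi>' a\<bar> \<le> \<epsilon> / 3)"
    by (rule rho_weak_star_continuous_scaled[OF eC contC \<pi> \<open>0 \<le> 1 - t\<close> \<open>0 < \<epsilon> / 3\<close>])
  \<comment> \<open>The third bound keeps the change of weight times \<open>M\<close> below
    \<open>\<epsilon> / 3\<close>; \<open>M + 1\<close> avoids division by zero.\<close>
  define \<delta> where "\<delta> = min (min \<delta>1 \<delta>2) (\<epsilon> / 3 / (M + 1))"
  have \<delta>: "0 < \<delta>" "\<delta> \<le> \<delta>1" "\<delta> \<le> \<delta>2" "\<delta> \<le> \<epsilon> / 3 / (M + 1)"
    using F1(2) F2(2) \<epsilon> M(1) by (auto simp: \<delta>_def)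
  have "\<delta> * M \<le> \<delta> * (M + 1)" using \<delta>(1) by simp
  also have "\<dots> \<le> \<epsilon> / 3"
    by (rule pos_le_divide_eq[THEN iffD1, rotated]) (use \<delta>(4) M(1) in linarith)+
  finally have \<delta>M: "\<delta> * M \<le> \<epsilon> / 3" .
  \<comment> \<open>Evaluation at \<open>(eA, 0)\<close> reads off the weight \<open>t\<close>; the
    other points read off the scaled components.\<close>
  define F where "F = insert (eA, 0) ((\<lambda>a. (a, 0)) ` F1 \<union> (\<lambda>c. (0, c)) ` F2)"
  have "\<bar>\<nu> x - \<nu>' x\<bar> \<le> \<epsilon>"
    if \<nu>': "\<nu>' \<in> states (eA, eC)" and close: "\<forall>x\<in>F. \<bar>\<nu>' x - \<nu> x\<bar> < \<delta>" and x: "L3 x \<le> 1" for \<nu>' x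
  proof -
    obtain t' \<mu>' \<pi>' where t': "0 \<le> t'" "t' \<le> 1" and \<mu>': "\<mu>' \<in> states eA" and \<pi>': "\<pi>' \<in> states eC"
      and eq': "\<nu>' = (\<lambda>x. t' * \<mu>' (fst x) + (1 - t') * \<pi>' (snd x))"
      by (rule state_prod_decompose[OF eA eC \<nu>' SA SC])
    have zero: "\<mu> 0 = 0" "\<mu>' 0 = 0" "\<pi> 0 = 0" "\<pi>' 0 = 0"
      using \<mu> \<mu>' \<pi> \<pi>' by (auto dest!: states_linear simp: linear_0)
    have tt: "\<bar>t' - t\<bar> < \<delta>"
      using close states_unit[OF \<mu>] states_unit[OF \<mu>'] zero by (simp add: F_def eq eq')
    have c1: "\<bar>t' * \<mu>' a - t * \<mu> a\<bar> < \<delta>1" if "a \<in> F1" for a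
    proof -
      have "(a, 0) \<in> F" using that by (simp add: F_def)
      with close have "\<bar>\<nu>' (a, 0) - \<nu> (a, 0)\<bar> < \<delta>" by blast
      with \<delta>(2) zero show ?thesis by (simp add: eq eq')
    qed
    have c2: "\<bar>(1 - t') * \<pi>' c - (1 - t) * \<pi> c\<bar> < \<delta>2" if "c \<in> F2" for c
    proof -
      have "(0, c) \<in> F" using that by (simp add: F_def)
      with close have "\<bar>\<nu>' (0, c) - \<nu> (0, c)\<bar> < \<delta>" by blast
      with \<delta>(3) zero show ?thesis by (simp add: eq eq')
    qed
    obtain a c where xac: "x = (a, c)" by fastforce
    have "LA a \<le> 1" "LC c \<le> 1" using glued_ge[where a = a and c = c] x xac by auto
    have 1: "t * \<bar>\<mu> a - \<mu>' a\<bar> \<le> \<epsilon> / 3"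
      by (rule near1[rule_format, OF \<mu>' _ c1 \<open>LA a \<le> 1\<close>]) (use tt \<delta>(2) in linarith)
    have 2: "(1 - t) * \<bar>\<pi> c - \<pi>' c\<bar> \<le> \<epsilon> / 3"
      by (rule near2[rule_format, OF \<pi>' _ c2 \<open>LC c \<le> 1\<close>]) (use tt \<delta>(3) in linarith)
    have "\<bar>\<mu>' a - \<pi>' c\<bar> \<le> M"
      using M(2)[OF \<mu>' \<pi>', of a c] mult_left_mono[OF x M(1)] xac by simp
    then have "\<bar>t' - t\<bar> * \<bar>\<mu>' a - \<pi>' c\<bar> \<le> \<delta> * M" using tt \<delta>(1) by (intro mult_mono) auto
    then have 3: "\<bar>t' - t\<bar> * \<bar>\<mu>' a - \<pi>' c\<bar> \<le> \<epsilon> / 3" using \<delta>M by linarith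
    \<comment> \<open>The weights \<open>t\<close> and \<open>1 - t\<close> stay on the differences
      of states; the change of weight meets only the primed states, whose difference
      \<open>M\<close> bounds.\<close>
    have "\<nu> x - \<nu>' x = t * (\<mu> a - \<mu>' a) + (1 - t) * (\<pi> c - \<pi>' c) - (t' - t) * (\<mu>' a - \<pi>' c)"
      by (simp add: xac eq eq' algebra_simps)
    also have "\<bar>\<dots>\<bar> \<le> \<bar>t * (\<mu> a - \<mu>' a)\<bar> + \<bar>(1 - t) * (\<pi> c - \<pi>' c)\<bar> + \<bar>(t' - t) * (\<mu>' a - \<pi>' c)\<bar>"
      by linarith
    also have "\<dots> = t * \<bar>\<mu> a - \<mu>' a\<bar> + (1 - t) * \<bar>\<pi> c - \<pi>' c\<bar> + \<bar>t' - t\<bar> * \<bar>\<mu>' a - \<pi>' c\<bar>"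
      using t by (simp add: abs_mult)
    finally show ?thesis using 1 2 3 by linarith
  qed
  moreover have "finite F" using F1(1) F2(1) by (simp add: F_def)
  ultimately show "\<exists>F \<delta>. finite F \<and> 0 < \<delta> \<and> (\<forall>\<nu>'\<in>states (eA, eC).
      (\<forall>x\<in>F. \<bar>\<nu>' x - \<nu> x\<bar> < \<delta>) \<longrightarrow> (\<forall>x. L3 x \<le> 1 \<longrightarrow> \<bar>\<nu> x - \<nu>' x\<bar> \<le> \<epsilon>))"
    using \<delta>(1) by (intro exI[of _ F] exI[of _ \<delta>]) blast
qed

lemma glued_admissible: "L3 \<in> admissible_lip_norms eA LA eC LC"
  unfolding admissible_lip_norms_def lip_norm_iff
  using seminorm_glued[OF s1 s2] glued_kernel glued_continuous glued_marginals[OF L1 L2] by blast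

end

section \<open>Hausdorff distances\<close>

text \<open>If the right side is finite, near-minimisers with slack \<open>\<epsilon> / 2\<close>
  each give the bound. An empty index set makes the right side infinite.\<close>

lemma le_INF_add_INF:
  fixes f :: "'i \<Rightarrow> ennreal" and g :: "'j \<Rightarrow> ennreal"
  assumes le: "\<And>i j. i \<in> I \<Longrightarrow> j \<in> J \<Longrightarrow> x \<le> f i + g j"
  shows "x \<le> (INF i\<in>I. f i) + (INF j\<in>J. g j)"
proof (rule ennreal_le_epsilon)
  fix \<epsilon> :: real assume fin: "(INF i\<in>I. f i) + (INF j\<in>J. g j) < top" and \<epsilon>: "0 < \<epsilon>"
  have less: "u < u + ennreal (\<epsilon> / 2)" if "u < top" for u
    using that \<epsilon> by (cases u) (auto simp: ennreal_less_iff simp flip: ennreal_plus)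
  have "(INF i\<in>I. f i) < (INF i\<in>I. f i) + ennreal (\<epsilon> / 2)"
    by (rule less) (use fin in auto)
  then obtain i where i: "i \<in> I" "f i < (INF i\<in>I. f i) + ennreal (\<epsilon> / 2)"
    unfolding INF_less_iff by blast
  have "(INF j\<in>J. g j) < (INF j\<in>J. g j) + ennreal (\<epsilon> / 2)"
    by (rule less) (use fin in auto)
  then obtain j where j: "j \<in> J" "g j < (INF j\<in>J. g j) + ennreal (\<epsilon> / 2)"
    unfolding INF_less_iff by blast
  have "x \<le> f i + g j" by (rule le[OF i(1) j(1)])
  also have "\<dots> \<le> ((INF i\<in>I. f i) + ennreal (\<epsilon> / 2)) + ((INF j\<in>J. g j) + ennreal (\<epsilon> / 2))"
    using i(2) j(2) by (intro add_mono less_imp_le)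
  also have "\<dots> = (INF i\<in>I. f i) + (INF j\<in>J. g j) + (ennreal (\<epsilon> / 2) + ennreal (\<epsilon> / 2))"
    by (simp add: ac_simps)
  also have "ennreal (\<epsilon> / 2) + ennreal (\<epsilon> / 2) = ennreal \<epsilon>"
    using \<epsilon> by (simp flip: ennreal_plus)
  finally show "x \<le> (INF i\<in>I. f i) + (INF j\<in>J. g j) + ennreal \<epsilon>" .
qed

lemma one_sided_distance_triangle:
  fixes d1 :: "'x \<Rightarrow> 'y \<Rightarrow> ennreal" and d2 :: "'y \<Rightarrow> 'z \<Rightarrow> ennreal"
  assumes d: "\<And>x y z. x \<in> X \<Longrightarrow> y \<in> Y \<Longrightarrow> z \<in> Z \<Longrightarrow> d3 x z \<le> d1 x y + d2 y z"
  shows "(SUP x\<in>X. INF z\<in>Z. d3 x z) \<le> (SUP x\<in>X. INF y\<in>Y. d1 x y) + (SUP y\<in>Y. INF z\<in>Z. d2 y z)"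
    (is "_ \<le> ?H1 + ?H2")
proof (rule SUP_least)
  fix x assume x: "x \<in> X"
  have "(INF z\<in>Z. d3 x z) \<le> d1 x y + ?H2" if y: "y \<in> Y" for y
  proof -
    \<comment> \<open>The singleton index set presents a constant as an infimum, so that
      \<open>le_INF_add_INF\<close> applies.\<close>
    have "(INF z\<in>Z. d3 x z) \<le> (INF y'\<in>{y}. d1 x y') + (INF z\<in>Z. d2 y z)"
    proof (rule le_INF_add_INF)
      fix y' z assume "y' \<in> {y}" and z: "z \<in> Z"
      have "(INF z\<in>Z. d3 x z) \<le> d3 x z" using z by (rule INF_lower)
      also have "\<dots> \<le> d1 x y + d2 y z" by (rule d[OF x y z])
      finally show "(INF z\<in>Z. d3 x z) \<le> d1 x y' + d2 y z" using \<open>y' \<in> {y}\<close> by simp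
    qed
    also have "\<dots> \<le> d1 x y + ?H2"
      using y by (auto intro!: add_left_mono SUP_upper2[of y])
    finally show ?thesis .
  qed
  then have "(INF z\<in>Z. d3 x z) \<le> (INF y\<in>Y. d1 x y) + (INF c\<in>{?H2}. c)"
    by (intro le_INF_add_INF) auto
  also have "\<dots> \<le> ?H1 + ?H2" using x by (auto intro!: add_right_mono SUP_upper)
  finally show "(INF z\<in>Z. d3 x z) \<le> ?H1 + ?H2" .
qed

text \<open>Stated for images because the middle set \<open>Y\<close> is embedded twice: states of
  \<open>B\<close> are pulled back to different direct sums by \<open>g1\<close> and
  \<open>f2\<close>.\<close>

lemma hausdorff_distance_triangle:
  assumes d: "\<And>x y z. x \<in> X \<Longrightarrow> y \<in> Y \<Longrightarrow> z \<in> Z \<Longrightarrow> d3 (f3 x) (g3 z) \<le> d1 (f1 x) (g1 y) + d2 (f2 y) (g2 z)"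
  shows "hausdorff_distance d3 (f3 ` X) (g3 ` Z)
    \<le> hausdorff_distance d1 (f1 ` X) (g1 ` Y) + hausdorff_distance d2 (f2 ` Y) (g2 ` Z)"
proof -
  have "(SUP x\<in>X. INF z\<in>Z. d3 (f3 x) (g3 z))
      \<le> (SUP x\<in>X. INF y\<in>Y. d1 (f1 x) (g1 y)) + (SUP y\<in>Y. INF z\<in>Z. d2 (f2 y) (g2 z))"
    by (rule one_sided_distance_triangle) (rule d)
  \<comment> \<open>The other half travels from \<open>Z\<close> to \<open>X\<close>, so
    \<open>d2\<close> comes first.\<close>
  moreover have "(SUP z\<in>Z. INF x\<in>X. d3 (f3 x) (g3 z))
      \<le> (SUP z\<in>Z. INF y\<in>Y. d2 (f2 y) (g2 z)) + (SUP y\<in>Y. INF x\<in>X. d1 (f1 x) (g1 y))"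
    by (rule one_sided_distance_triangle) (subst add.commute, rule d)
  then have "(SUP z\<in>Z. INF x\<in>X. d3 (f3 x) (g3 z))
      \<le> (SUP y\<in>Y. INF x\<in>X. d1 (f1 x) (g1 y)) + (SUP z\<in>Z. INF y\<in>Y. d2 (f2 y) (g2 z))"
    by (simp only: add.commute)
  ultimately show ?thesis
    unfolding hausdorff_distance_def image_comp comp_def
    by (meson add_mono max.boundedI max.cobounded1 max.cobounded2 order_trans)
qed

lemma hausdorff_distance_empty:
  assumes "X \<noteq> {}"
  shows "hausdorff_distance d X {} = top" "hausdorff_distance d {} X = top"
  using assms by (auto simp: hausdorff_distance_def)

section \<open>Units without states\<close>

text \<open>Gluing through \<open>B\<close> may fail to have the right kernel when there are no states, so an admissible
  Lip-norm is written down directly.\<close>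

lemma admissible_lip_norms_nonempty:
  fixes eA :: "'a::ordered_real_vector" and eC :: "'c::ordered_real_vector"
  assumes A: "lip_norm eA LA" and C: "lip_norm eC LC" and S: "states (eA, eC) = {}"
  shows "admissible_lip_norms eA LA eC LC \<noteq> {}"
proof -
  have sA: "seminorm LA" and sC: "seminorm LC" using A C by (auto simp: lip_norm_def)
  have kA: "LA (r *\<^sub>R eA) = 0" and kC: "LC (r *\<^sub>R eC) = 0" for r
    using A C unfolding lip_norm_def by blast+
  \<comment> \<open>If both units are nonzero, these functionals take the value 1 at them. Otherwise
    both are 0, and \<open>q\<close> in \<open>diag\<close> is the coefficient of the unit that may
    be nonzero.\<close>
  obtain f g where lin: "linear f" "linear g"
    and fg: "\<And>a. f a * g eC = (f a :: real)" "\<And>c. g c * f eA = (g c :: real)"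
    and diag: "\<And>r s. r * f eA = s * g eC \<Longrightarrow> \<exists>q. r *\<^sub>R eA = q *\<^sub>R eA \<and> s *\<^sub>R eC = q *\<^sub>R eC"
    and unit: "f eA = g eC"
  proof (cases "eA = 0 \<or> eC = 0")
    case True
    then show thesis by (intro that[of "\<lambda>_. 0" "\<lambda>_. 0"]) (auto intro!: linearI)
  next
    case False
    have unit_functional: "\<exists>h :: 'v \<Rightarrow> real. linear h \<and> h e = 1" if "e \<noteq> 0" for e :: "'v::real_vector"
      using linear_independent_extend[of "{e}" "\<lambda>_. 1 :: real"] that by auto
    from False obtain f g where "linear f" "f eA = (1 :: real)" "linear g" "g eC = (1 :: real)"
      using unit_functional[of eA] unit_functional[of eC] by blast
    then show thesis by (intro that[of f g]) auto
  qed
  \<comment> \<open>The last term forces the two coefficients of a kernel element to match.\<close>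
  define L where "L x = max (max (LA (fst x)) (LC (snd x))) \<bar>f (fst x) - g (snd x)\<bar>" for x
  have "seminorm L"
    unfolding seminorm_def
  proof (intro conjI allI)
    fix x y r
    show "0 \<le> L x" by (simp add: L_def le_max_iff_disj)
    have "\<bar>f (fst (x + y)) - g (snd (x + y))\<bar> \<le> \<bar>f (fst x) - g (snd x)\<bar> + \<bar>f (fst y) - g (snd y)\<bar>"
      using lin by (simp add: linear_add)
    then show "L (x + y) \<le> L x + L y"
      using seminorm_triangle[OF sA, of "fst x" "fst y"] seminorm_triangle[OF sC, of "snd x" "snd y"]
      unfolding L_def fst_add snd_add by linarith
    have "\<bar>f (fst (r *\<^sub>R x)) - g (snd (r *\<^sub>R x))\<bar> = \<bar>r\<bar> * \<bar>f (fst x) - g (snd x)\<bar>"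
      using lin by (simp add: linear_cmul abs_mult flip: right_diff_distrib)
    then show "L (r *\<^sub>R x) = \<bar>r\<bar> * L x"
      using seminorm_scale[OF sA, of r "fst x"] seminorm_scale[OF sC, of r "snd x"]
      by (simp add: L_def max_mult_distrib_left)
  qed
  moreover have "L x = 0 \<longleftrightarrow> (\<exists>q. x = q *\<^sub>R (eA, eC))" for x
  proof
    assume "L x = 0"
    then have "LA (fst x) = 0" "LC (snd x) = 0" and eq: "f (fst x) = g (snd x)"
      using seminorm_nonneg[OF sA, of "fst x"] seminorm_nonneg[OF sC, of "snd x"]
      unfolding L_def by linarith+
    then obtain r s where rs: "fst x = r *\<^sub>R eA" "snd x = s *\<^sub>R eC"
      using A C unfolding lip_norm_def by blast
    with eq lin have "r * f eA = s * g eC" by (simp add: linear_cmul)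
    then obtain q where "r *\<^sub>R eA = q *\<^sub>R eA" "s *\<^sub>R eC = q *\<^sub>R eC" using diag by blast
    with rs have "x = q *\<^sub>R (eA, eC)" by (simp add: prod_eq_iff)
    then show "\<exists>q. x = q *\<^sub>R (eA, eC)" ..
  next
    assume "\<exists>q. x = q *\<^sub>R (eA, eC)"
    then obtain q where x: "x = q *\<^sub>R (eA, eC)" ..
    show "L x = 0" using lin by (simp add: x L_def kA kC linear_cmul unit)
  qed
  moreover have "rho_weak_star_continuous (eA, eC) L"
    using S by (simp add: rho_weak_star_continuous_def)
  moreover have "LA a = (INF c. L (a, c))" for a
  proof (rule real_INF_eqI)
    \<comment> \<open>On multiples of \<open>eC\<close> the seminorm \<open>LC\<close> vanishes, and
      the coefficient \<open>f a\<close> cancels the last term; the infimum is attained.\<close>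
    have "L (a, f a *\<^sub>R eC) = LA a"
      using fg(1)[of a] seminorm_nonneg[OF sA, of a] unfolding L_def fst_conv snd_conv kC
      by (simp only: linear_cmul[OF lin(2)] real_scaleR_def)
    then show "\<exists>c. L (a, c) < LA a + \<epsilon>" if "0 < \<epsilon>" for \<epsilon>
      using that by (intro exI[of _ "f a *\<^sub>R eC"]) simp
  qed (simp add: L_def)
  moreover have "LC c = (INF a. L (a, c))" for c
  proof (rule real_INF_eqI)
    have "L (g c *\<^sub>R eA, c) = LC c"
      using fg(2)[of c] seminorm_nonneg[OF sC, of c] unfolding L_def fst_conv snd_conv kA
      by (simp only: linear_cmul[OF lin(1)] real_scaleR_def)
    then show "\<exists>a. L (a, c) < LC c + \<epsilon>" if "0 < \<epsilon>" for \<epsilon>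
      using that by (intro exI[of _ "g c *\<^sub>R eA"]) simp
  qed (simp add: L_def)
  ultimately have "L \<in> admissible_lip_norms eA LA eC LC"
    unfolding admissible_lip_norms_def lip_norm_iff by simp
  then show ?thesis by blast
qed

theorem theorem4p3:
  fixes eA :: "'a::ordered_real_vector" and LA :: "'a \<Rightarrow> real"
    and eB :: "'b::ordered_real_vector" and LB :: "'b \<Rightarrow> real"
    and eC :: "'c::ordered_real_vector" and LC :: "'c \<Rightarrow> real"
  assumes "compact_quantum_metric_space eA LA"
    and "compact_quantum_metric_space eB LB"
    and "compact_quantum_metric_space eC LC"
  shows "dist_q eA LA eC LC \<le> dist_q eA LA eB LB + dist_q eB LB eC LC"
proof -
  have oA: "order_unit_space eA" and oB: "order_unit_space eB" and oC: "order_unit_space eC"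
    and lA: "lip_norm eA LA" and lC: "lip_norm eC LC"
    using assms by (auto simp: compact_quantum_metric_space_def)
  let ?H1 = "\<lambda>L. hausdorff_distance (rho L) ((\<lambda>\<mu>. \<mu> \<circ> fst) ` states eA) ((\<lambda>\<nu>. \<nu> \<circ> snd) ` states eB)"
  let ?H2 = "\<lambda>L. hausdorff_distance (rho L) ((\<lambda>\<mu>. \<mu> \<circ> fst) ` states eB) ((\<lambda>\<nu>. \<nu> \<circ> snd) ` states eC)"
  let ?H3 = "\<lambda>L. hausdorff_distance (rho L) ((\<lambda>\<mu>. \<mu> \<circ> fst) ` states eA) ((\<lambda>\<nu>. \<nu> \<circ> snd) ` states eC)"
  show ?thesis
  proof (cases "states eA = {} \<and> states eC = {}")
    case True
    \<comment> \<open>Empty state spaces have distance 0, but \<open>dist_q\<close> is 0 only if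
      some admissible Lip-norm exists.\<close>
    then obtain L where L: "L \<in> admissible_lip_norms eA LA eC LC"
      using admissible_lip_norms_nonempty[OF lA lC] states_prod_empty[OF oA _ oC] by blast
    have "dist_q eA LA eC LC \<le> ?H3 L" unfolding dist_q_def by (rule INF_lower[OF L])
    also have "\<dots> = 0" using True by (simp add: hausdorff_distance_def bot_ennreal)
    finally show ?thesis by simp
  next
    case False
    have "dist_q eA LA eC LC \<le> ?H1 L1 + ?H2 L2"
      if L1: "L1 \<in> admissible_lip_norms eA LA eB LB" and L2: "L2 \<in> admissible_lip_norms eB LB eC LC"
      for L1 L2
    proof (cases "states eA = {} \<or> states eB = {} \<or> states eC = {}")
      case True
      \<comment> \<open>Some state space is empty, but not both outer ones. Hence emptiness changes
        between \<open>A\<close> and \<open>B\<close> or between \<open>B\<close> and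
        \<open>C\<close>, and the right side is infinite.\<close>
      have "?H1 L1 = top" if "(states eA = {}) \<noteq> (states eB = {})"
        using that by (cases "states eA = {}") (simp_all add: hausdorff_distance_empty)
      moreover have "?H2 L2 = top" if "(states eB = {}) \<noteq> (states eC = {})"
        using that by (cases "states eB = {}") (simp_all add: hausdorff_distance_empty)
      ultimately have "?H1 L1 = top \<or> ?H2 L2 = top" using True False by argo
      then show ?thesis by auto
    next
      case False
      then interpret gluing eA LA eB LB eC LC L1 L2
        using oA oB oC lA lC L1 L2 by unfold_locales (auto intro: positive_unitI)
      have "dist_q eA LA eC LC \<le> ?H3 L3" unfolding dist_q_def by (rule INF_lower[OF glued_admissible])
      also have "\<dots> \<le> ?H1 L1 + ?H2 L2"
        by (rule hausdorff_distance_triangle) (rule rho_glued_triangle)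
      finally show ?thesis .
    qed
    then show ?thesis
      unfolding dist_q_def[of eA LA eB] dist_q_def[of eB] by (rule le_INF_add_INF)
  qed
qed

end
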